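(* Let $A_i\in\mathbb{R}^{n\times n}$, $b_i\in\mathbb{R}^n$ for $i\in\mathbb{N}_N:=\{1,\dots,N\}$, and suppose there exists $\lambda^*\in\mathbb{R}^N$ with $\lambda^*_i\in[0,1]$ for all $i$ and $\sum_{i=1}^N\lambda^*_i=1$ such that $A_{\lambda^*}:=\sum_{i=1}^N\lambda_i^*A_i$ is Hurwitz and $b_{\lambda^*}:=\sum_{i=1}^N\lambda_i^*b_i=0$. Let $p\in(1,\infty)$, and let $R\in\mathbb{R}^{r\times n}$ and $S\in\mathbb{R}^{s\times n}$ be full column rank matrices such that $$\langle \nabla V_{R,p}(x), A_{\lambda^*}x\rangle + V_{S,p}(x)\le 0\quad\text{for all }x\in\mathbb{R}^n.$$ Let $\eta\in(0,1)$. Then there exist $T_M>0$, a strictly increasing function $\varepsilon:(0,T_M)\to\mathbb{R}_{>0}$ satisfying $\lim_{T\to0^+}\varepsilon(T)=0$, a function $\beta\in\mathcal{KL}$, and a function $\alpha\in\mathcal{K}_\infty$ such that for every $T\in(0,T_M)$ and every solution $\phi$ to the time-regularized hybrid system $\mathcal{H}_T$ defined in the context, with initial condition $\phi(0,0)=(x_0,\sigma_0,\tau_0)$, the following statements hold for all $(t,j)\in\operatorname{dom}\phi$: (a) $\|\phi(t,j)\|_{\mathcal{A}_T}\le\beta\big(\|\phi(0,0)\|_{\mathcal{A}_T}+\alpha(\Delta_0),\,t+j\big)$; (b) $t\ge(j-1)T$; where $\mathcal{A}_T:=\{(x,\sigma,\tau)\in\mathbb{R}^n\times\mathbb{N}_N\times[0,2T]:V_{R,p}(x)\le\varepsilon(T)\}$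 and $\Delta_0:=\max\{0,\,T-\tau_0\}$.
   Context: Weighted $p$-norm functions: for a full column rank matrix $M\in\mathbb{R}^{m\times n}$, $V_{M,p}(x):=\frac1p\|Mx\|_p^p=\frac1p\sum_{i=1}^m|M_{i:}x|^p$ ($M_{i:}$ the $i$-th row), which is differentiable for $p\in(1,\infty)$; $\langle x,y\rangle:=x^\top y$. A matrix is Hurwitz if all its eigenvalues have negative real part. Write $f_k(x):=A_kx+b_k$ for $k\in\mathbb{N}_N$. Let $\mathcal{C}:=\{(x,\sigma)\in\mathbb{R}^n\times\mathbb{N}_N:\langle\nabla V_{R,p}(x),f_\sigma(x)\rangle\le-\eta V_{S,p}(x)\}$ and $\mathcal{D}:=\{(x,\sigma)\in\mathbb{R}^n\times\mathbb{N}_N:\langle\nabla V_{R,p}(x),f_\sigma(x)\rangle\ge-\eta V_{S,p}(x)\}$. Hybrid system $\mathcal{H}_T$ ($T>0$) with state $(x,\sigma,\tau)$, $x\in\mathbb{R}^n$, $\sigma\in\mathbb{N}_N$, $\tau\in\mathbb{R}_{\ge0}$ (a timer). Flow set $\mathcal{C}_T:=(\mathcal{C}\times[0,2T])\cup(\mathbb{R}^n\times\mathbb{N}_N\times[0,T])$, on which the flow is $\dot x=f_\sigma(x)$, $\dot\sigma=0$, $\dot\tau=\min\{1,\,2-\tau/T\}$. Jump set $\mathcal{D}_T:=\mathcal{D}\times[T,2T]$, on which jumps satisfy $x^+=x$, $\sigma^+\in\arg\min_{k\in\mathbb{N}_N}\langle\nabla V_{R,p}(x),f_k(x)\rangle$,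 $\tau^+=0$. Solutions (Goebel–Sanfelice–Teel framework): a hybrid time domain is a set $E\subset\mathbb{R}_{\ge0}\times\{0,1,2,\dots\}$ such that for each $(t',J)\in E$, $E\cap([0,t']\times\{0,\dots,J\})=\bigcup_{j=0}^{J}[t_j,t_{j+1}]\times\{j\}$ for some $0=t_0\le t_1\le\dots\le t_{J+1}$. A solution $\phi$ is a function on a hybrid time domain $\operatorname{dom}\phi$ such that $t\mapsto\phi(t,j)$ is locally absolutely continuous for each $j$, $\phi(0,0)\in\overline{\mathcal{C}_T}\cup\mathcal{D}_T$, and: (i) for each $j$ for which $I^j:=\{t:(t,j)\in\operatorname{dom}\phi\}$ has nonempty interior, $\phi(t,j)\in\mathcal{C}_T$ for all $t\in\operatorname{int}I^j$ and the flow equations hold for almost all $t\in I^j$; (ii) whenever $(t,j),(t,j+1)\in\operatorname{dom}\phi$, $\phi(t,j)\in\mathcal{D}_T$ and $\phi(t,j+1)$ is related to $\phi(t,j)$ by the jump rule. For a closed set $\mathcal{A}$, $\|z\|_{\mathcal{A}}:=\inf_{y\in\mathcal{A}}\|z-y\|_2$. A function $\alpha:\mathbb{R}_{\ge0}\to\mathbb{R}_{\ge0}$ is of class $\mathcal{K}_\infty$ if it is continuous, strictly increasing, unbounded and $\alpha(0)=0$. A function $\beta:\mathbb{R}_{\ge0}\times\mathbb{R}_{\ge0}\to\mathbb{R}_{\ge0}$ is of class $\mathcal{KL}$ if it is nondecreasing in its first argument, nonincreasing in its second argument, $\lim_{r\to0^+}\beta(r,s)=0$ for each $s\ge0$, and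 $\lim_{s\to\infty}\beta(r,s)=0$ for each $r\ge0$. *)

theory Defs
  imports "HOL-Analysis.Analysis"
begin

section \<open>Linear algebra and weighted norm functions\<close>

definition eigenvalue_of :: "complex \<Rightarrow> real^'n^'n \<Rightarrow> bool" where
  "eigenvalue_of z A \<longleftrightarrow>
     (\<exists>v :: complex^'n. v \<noteq> 0 \<and> map_matrix complex_of_real A *v v = z *s v)"

definition Hurwitz :: "real^'n^'n \<Rightarrow> bool" where
  "Hurwitz A \<longleftrightarrow> (\<forall>z. eigenvalue_of z A \<longrightarrow> Re z < 0)"

definition full_column_rank :: "real^'n^'m \<Rightarrow> bool" where
  "full_column_rank M \<longleftrightarrow> rank M = CARD('n)"

definition wnorm_fun :: "real^'n^'m \<Rightarrow> real \<Rightarrow> real^'n \<Rightarrow> real" where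
  "wnorm_fun M p x = 1 / p * (\<Sum>i\<in>UNIV. \<bar>row i M \<bullet> x\<bar> powr p)"

definition grad :: "('a::real_inner \<Rightarrow> real) \<Rightarrow> 'a \<Rightarrow> 'a" where
  "grad V x = (THE D. GDERIV V x :> D)"

section \<open>Hybrid systems\<close>

text \<open>The intervals of a division are nonempty, compact and have pairwise disjoint interiors;
  the union of the division need not be all of the set \<^term>\<open>I\<close>.\<close>

definition abs_continuous_on :: "real set \<Rightarrow> (real \<Rightarrow> 'a::real_normed_vector) \<Rightarrow> bool" where
  "abs_continuous_on I f \<longleftrightarrow>
     (\<forall>e>0. \<exists>d>0. \<forall>P. P division_of \<Union>P \<and> \<Union>P \<subseteq> I \<and> (\<Sum>K\<in>P. measure lborel K) < d \<longrightarrow>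
        (\<Sum>K\<in>P. norm (f (interval_upperbound K) - f (interval_lowerbound K))) < e)"

definition locally_abs_continuous_on :: "real set \<Rightarrow> (real \<Rightarrow> 'a::real_normed_vector) \<Rightarrow> bool" where
  "locally_abs_continuous_on I f \<longleftrightarrow> (\<forall>a b. {a..b} \<subseteq> I \<longrightarrow> abs_continuous_on {a..b} f)"

definition hybrid_time_domain :: "(real \<times> nat) set \<Rightarrow> bool" where
  "hybrid_time_domain E \<longleftrightarrow>
     E \<subseteq> {0..} \<times> UNIV \<and>
     (\<forall>(t', J)\<in>E. \<exists>ts :: nat \<Rightarrow> real.
        ts 0 = 0 \<and> (\<forall>j\<le>J. ts j \<le> ts (Suc j)) \<and>
        E \<inter> ({0..t'} \<times> {..J}) = (\<Union>j\<in>{..J}. {ts j..ts (Suc j)} \<times> {j}))"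

definition flow_interval :: "(real \<times> nat) set \<Rightarrow> nat \<Rightarrow> real set" where
  "flow_interval E j = {t. (t, j) \<in> E}"

text \<open>A solution of the hybrid system with flow set \<open>C\<close>, flow map \<open>F\<close>, jump set \<open>D\<close> and jump map
  \<open>G\<close> is a pair of a domain \<open>E\<close> and a function \<open>\<phi>\<close>, whose values off \<open>E\<close> are irrelevant.
  Both maps are set-valued; a flow equation is given by a singleton-valued \<open>F\<close>.\<close>

definition hybrid_solution ::
  "'z::real_normed_vector set \<Rightarrow> ('z \<Rightarrow> 'z set) \<Rightarrow> 'z set \<Rightarrow> ('z \<Rightarrow> 'z set) \<Rightarrow>
     (real \<times> nat) set \<Rightarrow> (real \<Rightarrow> nat \<Rightarrow> 'z) \<Rightarrow> bool" where
  "hybrid_solution C F D G E \<phi> \<longleftrightarrow>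
     hybrid_time_domain E \<and> (0, 0) \<in> E \<and>
     (\<forall>j. locally_abs_continuous_on (flow_interval E j) (\<lambda>t. \<phi> t j)) \<and>
     \<phi> 0 0 \<in> closure C \<union> D \<and>
     (\<forall>j. interior (flow_interval E j) \<noteq> {} \<longrightarrow>
        (\<forall>t\<in>interior (flow_interval E j). \<phi> t j \<in> C) \<and>
        (AE t in lebesgue. t \<in> flow_interval E j \<longrightarrow>
           (\<exists>d\<in>F (\<phi> t j).
              ((\<lambda>s. \<phi> s j) has_vector_derivative d) (at t within flow_interval E j)))) \<and>
     (\<forall>t j. (t, j) \<in> E \<and> (t, Suc j) \<in> E \<longrightarrow> \<phi> t j \<in> D \<and> \<phi> t (Suc j) \<in> G (\<phi> t j))"

section \<open>The time-regularized switched system\<close>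

text \<open>A state \<open>(x, \<sigma>, \<tau>)\<close> is a point of the Euclidean space of dimension \<open>n + 2\<close>: the mode \<open>\<sigma>\<close> is
  the real number \<^term>\<open>real k\<close> for some \<open>k\<close> in \<open>{1..N}\<close>.\<close>

type_synonym 'n hstate = "(real^'n) \<times> real \<times> real"

definition affine_mode ::
  "(nat \<Rightarrow> real^'n^'n) \<Rightarrow> (nat \<Rightarrow> real^'n) \<Rightarrow> nat \<Rightarrow> real^'n \<Rightarrow> real^'n" where
  "affine_mode A b k x = A k *v x + b k"

text \<open>In the following, \<open>f\<close> is the family of modes, and \<open>V\<close>, \<open>W\<close> are to be instantiated with the
  weighted norm functions of \<open>R\<close> and \<open>S\<close>, respectively.\<close>

definition flow_region ::
  "nat \<Rightarrow> (nat \<Rightarrow> real^'n \<Rightarrow> real^'n) \<Rightarrow> (real^'n \<Rightarrow> real) \<Rightarrow> (real^'n \<Rightarrow> real) \<Rightarrow> real \<Rightarrow>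
     ((real^'n) \<times> real) set" where
  "flow_region N f V W \<eta> =
     {(x, real k) | x k. k \<in> {1..N} \<and> grad V x \<bullet> f k x \<le> - \<eta> * W x}"

definition jump_region ::
  "nat \<Rightarrow> (nat \<Rightarrow> real^'n \<Rightarrow> real^'n) \<Rightarrow> (real^'n \<Rightarrow> real) \<Rightarrow> (real^'n \<Rightarrow> real) \<Rightarrow> real \<Rightarrow>
     ((real^'n) \<times> real) set" where
  "jump_region N f V W \<eta> =
     {(x, real k) | x k. k \<in> {1..N} \<and> grad V x \<bullet> f k x \<ge> - \<eta> * W x}"

definition flow_set ::
  "nat \<Rightarrow> (nat \<Rightarrow> real^'n \<Rightarrow> real^'n) \<Rightarrow> (real^'n \<Rightarrow> real) \<Rightarrow> (real^'n \<Rightarrow> real) \<Rightarrow> real \<Rightarrow> real \<Rightarrow>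
     'n hstate set" where
  "flow_set N f V W \<eta> T =
     {(x, \<sigma>, \<tau>). (x, \<sigma>) \<in> flow_region N f V W \<eta> \<and> \<tau> \<in> {0..2 * T}} \<union>
     UNIV \<times> real ` {1..N} \<times> {0..T}"

definition flow_map ::
  "nat \<Rightarrow> (nat \<Rightarrow> real^'n \<Rightarrow> real^'n) \<Rightarrow> real \<Rightarrow> 'n hstate \<Rightarrow> 'n hstate set" where
  "flow_map N f T = (\<lambda>(x, \<sigma>, \<tau>).
     {(f k x, 0, min 1 (2 - \<tau> / T)) | k. k \<in> {1..N} \<and> \<sigma> = real k})"

definition jump_set ::
  "nat \<Rightarrow> (nat \<Rightarrow> real^'n \<Rightarrow> real^'n) \<Rightarrow> (real^'n \<Rightarrow> real) \<Rightarrow> (real^'n \<Rightarrow> real) \<Rightarrow> real \<Rightarrow> real \<Rightarrow>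
     'n hstate set" where
  "jump_set N f V W \<eta> T =
     {(x, \<sigma>, \<tau>). (x, \<sigma>) \<in> jump_region N f V W \<eta> \<and> \<tau> \<in> {T..2 * T}}"

definition jump_map ::
  "nat \<Rightarrow> (nat \<Rightarrow> real^'n \<Rightarrow> real^'n) \<Rightarrow> (real^'n \<Rightarrow> real) \<Rightarrow> 'n hstate \<Rightarrow> 'n hstate set" where
  "jump_map N f V = (\<lambda>(x, \<sigma>, \<tau>).
     {(x, real k, 0) | k. is_arg_min (\<lambda>k. grad V x \<bullet> f k x) (\<lambda>k. k \<in> {1..N}) k})"

definition regularized_solution ::
  "nat \<Rightarrow> (nat \<Rightarrow> real^'n \<Rightarrow> real^'n) \<Rightarrow> (real^'n \<Rightarrow> real) \<Rightarrow> (real^'n \<Rightarrow> real) \<Rightarrow> real \<Rightarrow> real \<Rightarrow>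
     (real \<times> nat) set \<Rightarrow> (real \<Rightarrow> nat \<Rightarrow> 'n hstate) \<Rightarrow> bool" where
  "regularized_solution N f V W \<eta> T E \<phi> \<longleftrightarrow>
     hybrid_solution (flow_set N f V W \<eta> T) (flow_map N f T)
       (jump_set N f V W \<eta> T) (jump_map N f V) E \<phi>"

definition attractor :: "nat \<Rightarrow> (real^'n \<Rightarrow> real) \<Rightarrow> real \<Rightarrow> real \<Rightarrow> 'n hstate set" where
  "attractor N V c T = {x. V x \<le> c} \<times> real ` {1..N} \<times> {0..2 * T}"

section \<open>Comparison functions\<close>

text \<open>Functions on the nonnegative reals are total functions on \<^typ>\<open>real\<close> of which only the values
  at nonnegative arguments matter.\<close>

definition class_Kinf :: "(real \<Rightarrow> real) \<Rightarrow> bool" where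
  "class_Kinf \<alpha> \<longleftrightarrow>
     \<alpha> ` {0..} \<subseteq> {0..} \<and> continuous_on {0..} \<alpha> \<and> strict_mono_on {0..} \<alpha> \<and>
     \<not> bdd_above (\<alpha> ` {0..}) \<and> \<alpha> 0 = 0"

text \<open>As in the hybrid systems literature, continuity is not required, and monotonicity is not
  strict.\<close>

definition class_KL :: "(real \<Rightarrow> real \<Rightarrow> real) \<Rightarrow> bool" where
  "class_KL \<beta> \<longleftrightarrow>
     (\<forall>r\<ge>0. \<forall>s\<ge>0. \<beta> r s \<ge> 0) \<and>
     (\<forall>s\<ge>0. mono_on {0..} (\<lambda>r. \<beta> r s)) \<and>
     (\<forall>r\<ge>0. antimono_on {0..} (\<beta> r)) \<and>
     (\<forall>s\<ge>0. ((\<lambda>r. \<beta> r s) \<longlongrightarrow> 0) (at_right 0)) \<and>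
     (\<forall>r\<ge>0. (\<beta> r \<longlongrightarrow> 0) at_top)"

end

theory Submission
  imports Defs
begin

text \<open>
  Write \<open>V\<close>, \<open>W\<close> for the weighted norm functions of \<open>R\<close>, \<open>S\<close> and \<open>rate k x\<close> for the derivative of
  \<open>V\<close> along mode \<open>k\<close>. Averaging the modes with the weights \<open>l\<close> gives a field along which \<open>V\<close>
  decreases at rate at least \<open>W\<close> (the affine parts cancel), so the mode chosen at a jump satisfies
  \<open>rate k x \<le> - W x\<close>. A jump is only possible once \<open>rate k x \<ge> - \<eta> * W x\<close>.

  \<^emph>\<open>Dwell time.\<close> Passing from \<open>- W\<close> to \<open>- \<eta> * W\<close> takes a time \<open>h > 0\<close> that is uniform over all arcs
  starting outside the ball of radius \<open>\<delta>\<close>, and does not depend on \<open>T\<close>: homogeneity in the pair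
  (state, affine part) reduces the claim to starting points on the unit sphere with affine part
  \<open>u * b k\<close>, \<open>0 \<le> u \<le> 1 / \<delta>\<close>, where compactness applies (\<open>strong_decrease_near\<close>,
  \<open>arc_relative_displacement\<close>, \<open>dwell_exists\<close>).

  \<^emph>\<open>Choice of the level.\<close> Let \<open>radius T\<close> be roughly the least \<open>\<delta>\<close> with dwell time \<open>T\<close>, and
  \<open>level T\<close> a bound of \<open>V\<close> on everything reachable within time \<open>T\<close> from the ball of that radius. An arc
  that starts outside the ball decreases \<open>V\<close> throughout, exponentially, because the timer expires
  before the decrease is lost; an arc that starts inside stays below \<open>level T\<close> until the timer
  expires, and then the flow set forces decrease. Hence, after the initial timer has run out,
  \<open>V\<close> is bounded by the maximum of \<open>level T\<close> and a decaying exponential (\<open>run_decay\<close>).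

  \<^emph>\<open>The comparison function.\<close> The bound has to decay in \<open>t + j\<close> uniformly in \<open>T\<close>, although the
  regularization alone allows about \<open>t / T\<close> jumps. But while the state is still outside a
  fixed ball, consecutive jumps are separated by the dwell time of that ball, so the jumps are bounded
  in terms of \<open>t\<close> (\<open>run_jump_count\<close>). Together with boundedness and stability this gives the three
  uniform estimates from which a \<open>\<K>\<L>\<close> function arises as a supremum over all solutions
  (\<open>class_KL_from_uniform_bounds\<close>). The uncontrolled initial phase lasts at most \<open>\<Delta>\<^sub>0 \<le> T < 1\<close> and moves a
  state from a bounded set by \<open>O(\<Delta>\<^sub>0)\<close>, so the identity serves as \<open>\<alpha>\<close>.

  Solutions satisfy the flow equations almost everywhere only; a fundamental theorem of calculus for
  absolutely continuous functions makes every flow phase continuously differentiable up to its end points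
  (\<open>abs_continuous_has_vector_derivative\<close>, \<open>flow_arc\<close>).
\<close>

section \<open>The fundamental theorem of calculus for absolutely continuous functions\<close>

text \<open>The exceptional null set is covered by an open set of small measure. A gauge that keeps the
  intervals tagged in the null set inside this open set makes their contribution small by absolute continuity;
  the other intervals are handled as in the classical case.\<close>

lemma abs_continuous_has_integral:
  fixes f :: "real \<Rightarrow> 'a::euclidean_space"
  assumes "a \<le> b" and ac: "abs_continuous_on {a..b} f" and N: "negligible N"
    and der: "\<And>t. t \<in> {a..b} - N \<Longrightarrow> (f has_vector_derivative f' t) (at t within {a..b})"
  shows "(f' has_integral (f b - f a)) {a..b}"
proof -
  define h where "h t = (if t \<in> N then 0 else f' t)" for t
  \<comment> \<open>Integrating \<open>h\<close> instead of \<open>f'\<close> removes the terms \<open>content K * f' x\<close> at tags \<open>x \<in> N\<close>.\<close>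
  have "(h has_integral (f b - f a)) {a..b}"
    unfolding has_integral_real
  proof (intro allI impI)
    fix e :: real assume "e > 0"
    define c where "c = e / (2 * (b - a + 1))"
    have "c > 0" and c: "c * (b - a) < e / 2"
      using \<open>e > 0\<close> \<open>a \<le> b\<close> by (auto simp: c_def field_simps)
    obtain d0 where "d0 > 0" and d0: "\<And>P. \<lbrakk>P division_of \<Union>P; \<Union>P \<subseteq> {a..b}; (\<Sum>K\<in>P. measure lborel K) < d0\<rbrakk>
        \<Longrightarrow> (\<Sum>K\<in>P. norm (f (interval_upperbound K) - f (interval_lowerbound K))) < e / 2"
      using ac \<open>e > 0\<close> unfolding abs_continuous_on_def by (meson half_gt_zero)
    have Nm: "N \<in> sets lebesgue" "emeasure lebesgue N = 0"
      using N negligible_iff_null_sets by auto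
    obtain U where U: "open U" "N \<subseteq> U" "U - N \<in> lmeasurable" "emeasure lebesgue (U - N) < ennreal d0"
      using sets_lebesgue_outer_open[OF Nm(1) \<open>d0 > 0\<close>] by blast
    have UN: "U = (U - N) \<union> N" using U(2) by blast
    have Nl: "N \<in> lmeasurable" using N by (simp add: negligible_imp_measurable)
    have Ul: "U \<in> lmeasurable" using UN U(3) Nl by (metis fmeasurable.Un)
    have "measure lebesgue (U - N) < d0"
      using U(4) emeasure_eq_measure2[OF U(3)] by (simp add: ennreal_less_iff)
    moreover have "measure lebesgue U \<le> measure lebesgue (U - N) + measure lebesgue N"
      using UN measure_Un_le[of "U - N" lebesgue N] U(3) Nm(1) fmeasurableD by metis
    ultimately have Um: "measure lebesgue U < d0"
      using negligible_imp_measure0[OF N] by simp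
    have "\<exists>r>0. (t \<in> N \<longrightarrow> ball t r \<subseteq> U) \<and> (t \<in> {a..b} - N \<longrightarrow>
        (\<forall>y\<in>{a..b}. norm (y - t) < r \<longrightarrow> norm (f y - f t - (y - t) *\<^sub>R f' t) \<le> c * norm (y - t)))" for t
    proof (cases "t \<in> N")
      case True
      then show ?thesis using U(1,2) open_contains_ball by (metis (no_types, lifting) DiffD2 subsetD)
    next
      case False
      show ?thesis
      proof (cases "t \<in> {a..b}")
        case True
        with False have "(f has_vector_derivative f' t) (at t within {a..b})" by (intro der) auto
        then obtain r where "r > 0" "\<forall>y\<in>{a..b}. norm (y - t) < r \<longrightarrow>
            norm (f y - f t - (y - t) *\<^sub>R f' t) \<le> c * norm (y - t)"
          using \<open>c > 0\<close> unfolding has_vector_derivative_def has_derivative_within_alt by blast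
        with False show ?thesis by blast
      next
        case False
        with \<open>t \<notin> N\<close> show ?thesis by (intro exI[of _ 1]) auto
      qed
    qed
    then obtain r where r: "\<And>t. r t > 0" "\<And>t. t \<in> N \<Longrightarrow> ball t (r t) \<subseteq> U"
      "\<And>t y. \<lbrakk>t \<in> {a..b} - N; y \<in> {a..b}; norm (y - t) < r t\<rbrakk>
         \<Longrightarrow> norm (f y - f t - (y - t) *\<^sub>R f' t) \<le> c * norm (y - t)"
      by metis
    show "\<exists>\<gamma>. gauge \<gamma> \<and> (\<forall>\<D>. \<D> tagged_division_of {a..b} \<and> \<gamma> fine \<D> \<longrightarrow>
          norm ((\<Sum>(x, K)\<in>\<D>. measure lborel K *\<^sub>R h x) - (f b - f a)) < e)"
    proof (intro exI conjI allI impI)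
      show "gauge (\<lambda>t. ball t (r t))" using r(1) by (simp add: gauge_ball_dependent)
      fix p assume "p tagged_division_of {a..b} \<and> (\<lambda>t. ball t (r t)) fine p"
      then have p: "p tagged_division_of {a..b}" and fine: "(\<lambda>t. ball t (r t)) fine p" by auto
      note pD = tagged_division_ofD[OF p]
      have ba: "b - a = (\<Sum>(x,K)\<in>p. Sup K - Inf K)" "f b - f a = (\<Sum>(x,K)\<in>p. f (Sup K) - f (Inf K))"
        using additive_tagged_division_1[where f= "\<lambda>x. x"] additive_tagged_division_1[where f= f]
            \<open>a \<le> b\<close> p by auto
      define q where "q = {z \<in> p. fst z \<in> N}"
      define g where "g = (\<lambda>(x,K). measure lborel K *\<^sub>R h x - (f (Sup K) - f (Inf K)))"
      have qp: "q \<subseteq> p" by (auto simp: q_def)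
      have "finite p" using pD by simp
      have Kuv: "\<exists>u v. K = {u..v} \<and> u \<le> v \<and> x \<in> {u..v} \<and> {u..v} \<subseteq> {a..b} \<and> {u..v} \<subseteq> ball x (r x)"
        if xK: "(x,K) \<in> p" for x K
      proof -
        obtain u v where "K = cbox u v" using pD(4)[OF xK] by blast
        moreover have "x \<in> K" "K \<subseteq> {a..b}" "K \<subseteq> ball x (r x)"
          using pD(2,3)[OF xK] fineD[OF fine xK] by auto
        ultimately show ?thesis by (intro exI[of _ u] exI[of _ v]) auto
      qed
      have "(\<Sum>(x, K)\<in>p. measure lborel K *\<^sub>R h x) - (f b - f a) = sum g p"
        by (simp add: ba(2) g_def sum_subtractf case_prod_unfold)
      also have "\<dots> = sum g q + sum g (p - q)"
        using sum.subset_diff[OF qp \<open>finite p\<close>, of g] by (simp add: add.commute)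
      finally have eq: "(\<Sum>(x, K)\<in>p. measure lborel K *\<^sub>R h x) - (f b - f a) = sum g q + sum g (p - q)" .
      have "norm (sum g (p - q)) \<le> (\<Sum>(x,K)\<in>p - q. c * (Sup K - Inf K))"
      proof (rule sum_norm_le, clarify)
        fix x K assume xK: "(x, K) \<in> p" "(x, K) \<notin> q"
        then obtain u v where K: "K = {u..v}" "u \<le> v" "x \<in> {u..v}" "{u..v} \<subseteq> {a..b}" "{u..v} \<subseteq> ball x (r x)"
          using Kuv by blast
        have x: "x \<in> {a..b} - N" using xK K by (auto simp: q_def)
        have uv: "u \<in> {u..v}" "v \<in> {u..v}" using K(2) by auto
        then have "norm (u - x) < r x" "norm (v - x) < r x"
          using K(5) by (auto simp: dist_real_def subset_iff abs_minus_commute)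
        then have 1: "norm (f u - f x - (u - x) *\<^sub>R f' x) \<le> c * norm (u - x)"
          "norm (f v - f x - (v - x) *\<^sub>R f' x) \<le> c * norm (v - x)"
          using r(3)[OF x] uv K(4) by auto
        have "g (x, K) = (v - u) *\<^sub>R f' x - (f v - f u)"
          using K(1,2) x by (simp add: g_def h_def)
        also have "\<dots> = (f u - f x - (u - x) *\<^sub>R f' x) - (f v - f x - (v - x) *\<^sub>R f' x)"
          by (simp add: algebra_simps)
        finally have "g (x, K) = (f u - f x - (u - x) *\<^sub>R f' x) - (f v - f x - (v - x) *\<^sub>R f' x)" .
        then have "norm (g (x, K)) \<le> c * norm (u - x) + c * norm (v - x)"
          using add_mono[OF 1] norm_triangle_ineq4[of "f u - f x - (u - x) *\<^sub>R f' x"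
            "f v - f x - (v - x) *\<^sub>R f' x"] by simp
        also have "\<dots> = c * (Sup K - Inf K)" using K by (simp add: algebra_simps)
        finally show "norm (g (x, K)) \<le> c * (Sup K - Inf K)" .
      qed
      also have "\<dots> \<le> (\<Sum>(x,K)\<in>p. c * (Sup K - Inf K))"
      proof (rule sum_mono2[OF \<open>finite p\<close>])
        fix z assume "z \<in> p - (p - q)"
        then have "(fst z, snd z) \<in> p" by auto
        from Kuv[OF this] obtain u v where "snd z = {u..v}" "u \<le> v" by blast
        then show "0 \<le> (case z of (x, K) \<Rightarrow> c * (Sup K - Inf K))" using \<open>c > 0\<close> 
          by (simp add: case_prod_unfold)
      qed auto
      also have "\<dots> = c * (b - a)" by (simp add: ba(1) sum_distrib_left case_prod_unfold)
      finally have A: "norm (sum g (p - q)) < e / 2" using c by linarith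
      have qpart: "q tagged_partial_division_of {a..b}"
        using p qp tagged_partial_division_subset unfolding tagged_division_of_def by blast
      have div: "snd ` q division_of \<Union>(snd ` q)"
        by (rule partial_division_of_tagged_division[OF qpart])
      have sub: "\<Union>(snd ` q) \<subseteq> {a..b}" 
      proof (rule Sup_least)
        fix K assume "K \<in> snd ` q"
        then obtain x where "(x, K) \<in> p" using qp by auto
        then show "K \<subseteq> {a..b}" by (rule pD(3))
      qed
      have "\<Union>(snd ` q) \<subseteq> U"
      proof (rule Sup_least)
        fix K assume "K \<in> snd ` q"
        then obtain x where xK: "(x, K) \<in> p" and "x \<in> N" using qp by (auto simp: q_def)
        from r(2)[OF this(2)] fineD[OF fine xK] show "K \<subseteq> U" by simp
      qed
      then have "measure lebesgue (\<Union>(snd ` q)) \<le> measure lebesgue U"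
        using lmeasurable_division[OF div] Ul measure_mono_fmeasurable by blast
      moreover have "(\<Sum>K\<in>snd ` q. measure lborel K) = measure lebesgue (\<Union>(snd ` q))"
        unfolding content_division[OF div, symmetric]
      proof (rule sum.cong[OF refl])
        fix K assume "K \<in> snd ` q"
        with division_ofD(4)[OF div] obtain u v where "K = cbox u v" by blast
        then show "measure lborel K = measure lebesgue K" by simp
      qed
      ultimately have small: "(\<Sum>K\<in>snd ` q. measure lborel K) < d0" using Um by simp
      \<comment> \<open>The end points of the empty interval are unspecified, hence the case distinction.\<close>
      define w where "w K = (if K = {} then 0 else norm (f (interval_upperbound K) - f (interval_lowerbound K)))"
        for K
      have "norm (sum g q) \<le> (\<Sum>(x,K)\<in>q. w K)"
      proof (rule sum_norm_le, clarify)
        fix x K assume xK: "(x, K) \<in> q"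
        then obtain u v where K: "K = {u..v}" "u \<le> v" using Kuv qp by blast
        have "x \<in> N" using xK by (simp add: q_def)
        then show "norm (g (x, K)) \<le> w K"
          using K by (simp add: w_def g_def h_def interval_upperbound_real interval_lowerbound_real norm_minus_commute)
      qed
      also have "\<dots> = (\<Sum>K\<in>snd ` q. w K)"
      proof (rule sum.over_tagged_division_lemma[OF tagged_partial_division_of_Union_self[OF qpart]])
        fix u v :: real assume "box u v = {}"
        then have "v \<le> u" by (auto simp: box_eq_empty)
        then show "w (cbox u v) = 0"
          by (cases "u = v") (simp_all add: w_def interval_upperbound_real interval_lowerbound_real)
      qed
      also have "\<dots> = (\<Sum>K\<in>snd ` q. norm (f (interval_upperbound K) - f (interval_lowerbound K)))"
        using division_ofD(3)[OF div] by (intro sum.cong) (simp_all add: w_def)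
      also have "\<dots> < e / 2" by (rule d0[OF div sub small])
      finally have "norm (sum g q) < e / 2" .
      with A show "norm ((\<Sum>(x, K)\<in>p. measure lborel K *\<^sub>R h x) - (f b - f a)) < e"
        unfolding eq using norm_triangle_ineq[of "sum g q" "sum g (p - q)"] by linarith
    qed
  qed
  then show ?thesis
    by (rule has_integral_spike[OF N, rotated]) (simp add: h_def)
qed

lemma abs_continuous_on_subset:
  "abs_continuous_on I f \<Longrightarrow> J \<subseteq> I \<Longrightarrow> abs_continuous_on J f"
  unfolding abs_continuous_on_def by (meson order_trans)

lemma abs_continuous_on_imp_continuous:
  fixes f :: "real \<Rightarrow> 'a::real_normed_vector"
  assumes "abs_continuous_on {a..b} f"
  shows "continuous_on {a..b} f"
  unfolding continuous_on_iff
proof (intro ballI allI impI)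
  fix s e :: real assume s: "s \<in> {a..b}" and "e > 0"
  obtain d where "d > 0" and d: "\<And>P. \<lbrakk>P division_of \<Union>P; \<Union>P \<subseteq> {a..b}; (\<Sum>K\<in>P. measure lborel K) < d\<rbrakk>
        \<Longrightarrow> (\<Sum>K\<in>P. norm (f (interval_upperbound K) - f (interval_lowerbound K))) < e"
    using assms \<open>e > 0\<close> unfolding abs_continuous_on_def by meson
  have *: "norm (f v - f u) < e" if "u \<le> v" "u \<in> {a..b}" "v \<in> {a..b}" "v - u < d" for u v
  proof -
    have "{{u..v}} division_of \<Union>{{u..v}}"
      using that(1) division_of_self[of u v] by auto
    from d[OF this] that show ?thesis
      by (simp add: interval_upperbound_real interval_lowerbound_real)
  qed
  show "\<exists>d>0. \<forall>x'\<in>{a..b}. dist x' s < d \<longrightarrow> dist (f x') (f s) < e"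
  proof (intro exI conjI ballI impI)
    fix t assume t: "t \<in> {a..b}" "dist t s < d"
    show "dist (f t) (f s) < e"
      using *[of s t] *[of t s] s t by (cases "s \<le> t") (auto simp: dist_norm norm_minus_commute)
  qed fact
qed

lemma abs_continuous_has_vector_derivative:
  fixes f :: "real \<Rightarrow> 'a::euclidean_space"
  assumes "abs_continuous_on {a..b} f" "negligible N"
    and der: "\<And>t. t \<in> {a..b} - N \<Longrightarrow> (f has_vector_derivative g t) (at t within {a..b})"
    and cont: "continuous_on {a..b} g" and "t \<in> {a..b}"
  shows "(f has_vector_derivative g t) (at t within {a..b})"
proof -
  have "((\<lambda>u. f a + integral {a..u} g) has_vector_derivative g t) (at t within {a..b})"
    using integral_has_vector_derivative[OF cont \<open>t \<in> {a..b}\<close>]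
    by (auto intro!: derivative_eq_intros)
  moreover have "f u = f a + integral {a..u} g" if "u \<in> {a..b}" for u
  proof -
    have "(g has_integral (f u - f a)) {a..u}"
    proof (rule abs_continuous_has_integral)
      show "abs_continuous_on {a..u} f" 
        using assms(1) that by (auto elim!: abs_continuous_on_subset)
      fix t assume "t \<in> {a..u} - N"
      then show "(f has_vector_derivative g t) (at t within {a..u})"
        using that by (intro has_vector_derivative_within_subset[OF der]) auto
    qed (use that assms in auto)
    then show ?thesis by (simp add: integral_unique)
  qed
  ultimately show ?thesis
    using has_vector_derivative_transform[OF \<open>t \<in> {a..b}\<close>] by (metis (no_types, lifting))
qed

section \<open>Weighted norm functions\<close>

lemma has_real_derivative_abs_powr:
  fixes p y :: real
  assumes "p > 1"
  shows "((\<lambda>y. \<bar>y\<bar> powr p) has_real_derivative p * (sgn y * \<bar>y\<bar> powr (p - 1))) (at y)"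
proof -
  consider "y > 0" | "y < 0" | "y = 0" by linarith
  then show ?thesis
  proof cases
    case 1
    have "((\<lambda>y. y powr p) has_real_derivative p * y powr (p - 1)) (at y)"
      using has_real_derivative_powr[OF 1] by simp
    then show ?thesis
      using 1 by (auto intro: has_field_derivative_transform_within_open[where S="{0<..}"])
  next
    case 2
    have "((\<lambda>y. (- y) powr p) has_real_derivative p * (- y) powr (p - 1) * (- 1)) (at y)"
      using 2 by (auto intro!: derivative_eq_intros has_real_derivative_powr)
    then show ?thesis
      using 2 by (auto intro: has_field_derivative_transform_within_open[where S="{..<0}"])
  next
    case 3
    have "((\<lambda>h. \<bar>h\<bar> powr (p - 1)) \<longlongrightarrow> 0) (at (0::real))"
      using \<open>p > 1\<close> by (intro tendsto_eq_intros tendsto_zero_powrI[of _ _ _ "p - 1"]) (auto intro!: tendsto_eq_intros)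
    moreover have "\<bar>\<bar>h\<bar> powr p / h\<bar> = \<bar>h\<bar> powr (p - 1)" for h :: real
      by (cases "h = 0") (auto simp: powr_diff abs_mult)
    ultimately have "((\<lambda>h. \<bar>h\<bar> powr p / h) \<longlongrightarrow> 0) (at (0::real))"
      by (intro tendsto_rabs_zero_cancel[of "\<lambda>h. \<bar>h\<bar> powr p / h"]) (simp only:)
    then show ?thesis
      using 3 \<open>p > 1\<close> by (simp add: DERIV_def)
  qed
qed

definition wnorm_grad :: "real^'n^'m \<Rightarrow> real \<Rightarrow> real^'n \<Rightarrow> real^'n" where
  "wnorm_grad M p x = (\<Sum>i\<in>UNIV. (sgn (row i M \<bullet> x) * \<bar>row i M \<bullet> x\<bar> powr (p - 1)) *\<^sub>R row i M)"

lemma GDERIV_wnorm_fun: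
  assumes "p > 1"
  shows "GDERIV (wnorm_fun M p) x :> wnorm_grad M p x"
proof -
  have "((\<lambda>x. \<bar>row i M \<bullet> x\<bar> powr p) has_derivative
      (\<lambda>h. p * (sgn (row i M \<bullet> x) * \<bar>row i M \<bullet> x\<bar> powr (p - 1)) * (row i M \<bullet> h))) (at x)" for i
    by (rule has_derivative_compose[of "\<lambda>x. row i M \<bullet> x" "\<lambda>h. row i M \<bullet> h" x UNIV "\<lambda>y. \<bar>y\<bar> powr p",
            OF _ has_real_derivative_abs_powr[OF assms, unfolded has_field_derivative_def]])
       (intro has_derivative_inner_right has_derivative_ident)
  then have "((\<lambda>x. 1 / p * (\<Sum>i\<in>UNIV. \<bar>row i M \<bullet> x\<bar> powr p)) has_derivative
      (\<lambda>h. 1 / p * (\<Sum>i\<in>UNIV. p * (sgn (row i M \<bullet> x) * \<bar>row i M \<bullet> x\<bar> powr (p - 1)) * (row i M \<bullet> h)))) (at x)"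
    by (intro has_derivative_mult_right has_derivative_sum)
  moreover have "1 / p * (\<Sum>i\<in>UNIV. p * (sgn (row i M \<bullet> x) * \<bar>row i M \<bullet> x\<bar> powr (p - 1)) * (row i M \<bullet> h))
      = h \<bullet> wnorm_grad M p x" for h
    using assms by (simp add: wnorm_grad_def inner_sum_right sum_distrib_left inner_commute mult_ac)
  ultimately show ?thesis
    by (simp add: gderiv_def wnorm_fun_def[abs_def])
qed

lemma grad_eq:
  assumes "GDERIV V x :> D"
  shows "grad V x = D"
  unfolding grad_def
proof (rule the_equality[of "\<lambda>D. GDERIV V x :> D", OF assms])
  fix D' assume "GDERIV V x :> D'"
  then have "(\<lambda>h. h \<bullet> D') = (\<lambda>h. h \<bullet> D)"
    using assms unfolding gderiv_def by (rule has_derivative_unique)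
  then have "(D' - D) \<bullet> D' = (D' - D) \<bullet> D" by (rule fun_cong)
  then have "(D' - D) \<bullet> (D' - D) = 0" by (simp add: inner_diff_right)
  then show "D' = D" by simp
qed

lemma continuous_wnorm_grad:
  assumes "p > 1"
  shows "continuous_on S (wnorm_grad M p)"
proof -
  have eq: "sgn y * \<bar>y\<bar> powr (p - 1) = max y 0 powr (p - 1) - max (- y) 0 powr (p - 1)" for y :: real
    using assms by (auto simp: sgn_if max_def)
  show ?thesis
    unfolding wnorm_grad_def eq using assms
    by (intro continuous_intros continuous_on_powr') auto
qed

lemma wnorm_fun_scale:
  assumes "c \<ge> 0"
  shows "wnorm_fun M p (c *\<^sub>R x) = c powr p * wnorm_fun M p x"
  using assms by (simp add: wnorm_fun_def abs_mult powr_mult sum_distrib_left mult_ac)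

lemma wnorm_grad_scale:
  assumes "c > 0"
  shows "wnorm_grad M p (c *\<^sub>R x) = c powr (p - 1) *\<^sub>R wnorm_grad M p x"
  using assms by (simp add: wnorm_grad_def abs_mult powr_mult scaleR_sum_right sgn_mult mult_ac)

lemma wnorm_fun_pos:
  fixes M :: "real^'n^'m"
  assumes "full_column_rank M" "p > 0" "x \<noteq> 0"
  shows "wnorm_fun M p x > 0"
proof -
  have "inj ((*v) M)" using assms(1) by (simp add: full_column_rank_def full_rank_injective)
  then have "M *v x \<noteq> 0" using \<open>x \<noteq> 0\<close> by (metis injD matrix_vector_mult_0_right)
  then obtain i where "(M *v x) $ i \<noteq> 0" by (auto simp: vec_eq_iff)
  then have "row i M \<bullet> x \<noteq> 0"
    by (simp add: matrix_vector_mul_component row_def)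
  then have "0 < (\<Sum>i\<in>UNIV. \<bar>row i M \<bullet> x\<bar> powr p)"
    by (intro sum_pos2[of _ i]) auto
  then show ?thesis using assms by (simp add: wnorm_fun_def)
qed

section \<open>Affine flows, homogeneous functions and comparison functions\<close>

lemma decreasing_if_derivative_nonpos:
  fixes g :: "real \<Rightarrow> real"
  assumes der: "\<And>s. s \<in> {a..b} \<Longrightarrow> (g has_real_derivative g' s) (at s within {a..b})"
    and nonpos: "\<And>s. s \<in> {a<..<b} \<Longrightarrow> g' s \<le> 0" and "t \<in> {a..b}"
  shows "g t \<le> g a"
proof (rule DERIV_nonpos_imp_decreasing_open[where f = g and a = a and b = t])
  show "a \<le> t" using assms by simp
  show "continuous_on {a..t} g"
    using \<open>t \<in> {a..b}\<close>
    by (intro continuous_on_subset[OF DERIV_continuous_on[OF der]]) auto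
  fix s assume "a < s" "s < t"
  then have "s \<in> {a<..<b}" using \<open>t \<in> {a..b}\<close> by auto
  then show "\<exists>y. (g has_real_derivative y) (at s) \<and> y \<le> 0"
    using der[of s] nonpos[of s] at_within_Icc_at[of a s b] by auto
qed

text \<open>The shift by one makes the inhomogeneous equation as good as a linear one:
  \<open>2 * (x \<bullet> (B x + c)) \<le> 2 L (\<bar>x\<bar>\<^sup>2 + \<bar>x\<bar>) \<le> 3 L (\<bar>x\<bar>\<^sup>2 + 1)\<close>.\<close>
lemma affine_growth:
  fixes X :: "real \<Rightarrow> real^'n" and B :: "real^'n^'n"
  assumes der: "\<And>s. s \<in> {a..b} \<Longrightarrow> (X has_vector_derivative (B *v X s + c)) (at s within {a..b})"
    and B: "\<And>v. norm (B *v v) \<le> L * norm v" and c: "norm c \<le> L" and t: "t \<in> {a..b}"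
  shows "(norm (X t))\<^sup>2 + 1 \<le> ((norm (X a))\<^sup>2 + 1) * exp (3 * L * (t - a))"
proof -
  define g where "g s = (X s \<bullet> X s + 1) * exp (- (3 * L * (s - a)))" for s
  define g' where "g' s = (2 * (X s \<bullet> (B *v X s + c)) - 3 * L * (X s \<bullet> X s + 1)) * exp (- (3 * L * (s - a)))" for s
  have "L \<ge> 0" using c norm_ge_zero order_trans by blast
  have "g t \<le> g a"
  proof (rule decreasing_if_derivative_nonpos[OF _ _ t])
    fix s assume s: "s \<in> {a..b}"
    have "(X has_derivative (\<lambda>h. h *\<^sub>R (B *v X s + c))) (at s within {a..b})"
      using der[OF s] by (simp add: has_vector_derivative_def)
    then have "((\<lambda>s. X s \<bullet> X s) has_derivative (\<lambda>h. X s \<bullet> (h *\<^sub>R (B *v X s + c)) + h *\<^sub>R (B *v X s + c) \<bullet> X s)) (at s within {a..b})"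
      using has_derivative_inner by blast
    then have "((\<lambda>s. X s \<bullet> X s) has_real_derivative 2 * (X s \<bullet> (B *v X s + c))) (at s within {a..b})"
      unfolding has_field_derivative_def
      by (rule has_derivative_eq_rhs) (auto simp: inner_commute algebra_simps inner_add_right)
    then show "(g has_real_derivative g' s) (at s within {a..b})"
      unfolding g_def g'_def by (auto intro!: derivative_eq_intros simp: algebra_simps)
  next
    fix s assume "s \<in> {a<..<b}"
    have "X s \<bullet> (B *v X s + c) \<le> norm (X s) * norm (B *v X s + c)" by (rule norm_cauchy_schwarz)
    also have "\<dots> \<le> norm (X s) * (L * norm (X s) + L)"
      using B[of "X s"] c norm_triangle_ineq[of "B *v X s" c] by (intro mult_left_mono) auto
    also have "2 * \<dots> \<le> 3 * L * ((norm (X s))\<^sup>2 + 1)"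
    proof -
      have "0 \<le> L * (norm (X s) - 1)\<^sup>2" using \<open>L \<ge> 0\<close> by simp
      moreover have "0 \<le> 2 * L" using \<open>L \<ge> 0\<close> by simp
      ultimately show ?thesis by (simp add: power2_eq_square algebra_simps)
    qed
    finally show "g' s \<le> 0"
      by (simp add: g'_def mult_le_0_iff power2_norm_eq_inner)
  qed
  then show ?thesis
    by (simp add: g_def exp_minus divide_inverse[symmetric] power2_norm_eq_inner pos_divide_le_eq)
qed

lemma affine_displacement:
  fixes X :: "real \<Rightarrow> real^'n" and B :: "real^'n^'n"
  assumes der: "\<And>s. s \<in> {a..b} \<Longrightarrow> (X has_vector_derivative (B *v X s + c)) (at s within {a..b})"
    and B: "\<And>v. norm (B *v v) \<le> L * norm v" and c: "norm c \<le> L" and t: "t \<in> {a..b}"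
    and K: "\<And>s. s \<in> {a..b} \<Longrightarrow> norm (X s) \<le> K"
  shows "norm (X t - X a) \<le> L * (K + 1) * (t - a)"
proof -
  have "L \<ge> 0" using c norm_ge_zero order_trans by blast
  have "norm (X t - X a) \<le> L * (K + 1) * norm (t - a)"
  proof (rule differentiable_bound[where S = "{a..b}"])
    fix s assume s: "s \<in> {a..b}"
    show "(X has_derivative (\<lambda>h. h *\<^sub>R (B *v X s + c))) (at s within {a..b})"
      using der[OF s] by (simp add: has_vector_derivative_def)
    have "norm (B *v X s + c) \<le> L * norm (X s) + L"
      using B[of "X s"] c norm_triangle_ineq[of "B *v X s" c] by auto
    also have "\<dots> \<le> L * (K + 1)" using mult_left_mono[OF K[OF s] \<open>L \<ge> 0\<close>] by (simp add: algebra_simps)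
    finally have "norm (B *v X s + c) \<le> L * (K + 1)" .
    then show "onorm (\<lambda>h. h *\<^sub>R (B *v X s + c)) \<le> L * (K + 1)"
      by (intro onorm_le) (simp add: mult.commute mult_left_mono)
  qed (use t in auto)
  then show ?thesis using t by simp
qed

lemma homogeneous_bounds:
  fixes F :: "'a::euclidean_space \<Rightarrow> real"
  assumes cont: "continuous_on UNIV F"
    and hom: "\<And>c x. c \<ge> 0 \<Longrightarrow> F (c *\<^sub>R x) = c powr p * F x"
    and pos: "\<And>x. x \<noteq> 0 \<Longrightarrow> F x > 0"
  obtains m M where "m > 0" "M > 0" "\<And>x. m * norm x powr p \<le> F x" "\<And>x. F x \<le> M * norm x powr p"
proof -
  have c: "continuous_on (sphere 0 1) F" using cont continuous_on_subset by blast
  have comp: "compact (sphere (0::'a) 1)" "sphere (0::'a) 1 \<noteq> {}" by auto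
  obtain u where u: "u \<in> sphere 0 1" "\<And>y. y \<in> sphere 0 1 \<Longrightarrow> F u \<le> F y"
    using continuous_attains_inf[OF comp c] by auto
  obtain v where v: "v \<in> sphere 0 1" "\<And>y. y \<in> sphere 0 1 \<Longrightarrow> F y \<le> F v"
    using continuous_attains_sup[OF comp c] by auto
  have eq: "F x = norm x powr p * F (sgn x)" for x
    using hom[of "norm x" "sgn x"] by (cases "x = 0") (simp_all add: sgn_div_norm)
  have F0: "F 0 = 0" using hom[of 0 0] by simp
  show thesis
  proof
    show "F u > 0" "F v > 0" using u(1) v(1) pos[of u] pos[of v] by fastforce+
    show "F u * norm x powr p \<le> F x" for x
      using u(2)[of "sgn x"] eq[of x] F0 by (cases "x = 0") (auto simp: norm_sgn mult.commute intro!: mult_left_mono)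
    show "F x \<le> F v * norm x powr p" for x
      using v(2)[of "sgn x"] eq[of x] F0 by (cases "x = 0") (auto simp: norm_sgn mult.commute intro!: mult_left_mono)
  qed
qed

lemma infdist_ge_norm_minus:
  assumes "S \<noteq> {}" "\<And>y. y \<in> S \<Longrightarrow> norm y \<le> \<rho>"
  shows "norm x - \<rho> \<le> infdist x S"
  unfolding infdist_notempty[OF assms(1)]
proof (rule cINF_greatest[OF assms(1)])
  fix y assume "y \<in> S"
  then show "norm x - \<rho> \<le> dist x y"
    using assms(2)[of y] norm_triangle_ineq2[of x y] by (simp add: dist_norm)
qed

text \<open>Here \<open>Q r s d\<close> collects the distances \<open>d\<close> that occur at hybrid time \<open>s\<close> from initial size \<open>r\<close>. The
  supremum of all distances from initial size at most \<open>r\<close> at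
  times at least \<open>s\<close> has the required monotonicity by construction; the three hypotheses make it finite and
  give its two limits.\<close>
lemma class_KL_from_uniform_bounds:
  fixes Q :: "real \<Rightarrow> real \<Rightarrow> real \<Rightarrow> bool"
  assumes nonneg: "\<And>r s d. Q r s d \<Longrightarrow> 0 \<le> r \<and> 0 \<le> s \<and> 0 \<le> d"
    and bounded: "\<And>r. r \<ge> 0 \<Longrightarrow> \<exists>B. \<forall>r' s d. Q r' s d \<and> r' \<le> r \<longrightarrow> d \<le> B"
    and stable: "\<And>e. e > 0 \<Longrightarrow> \<exists>r>0. \<forall>r' s d. Q r' s d \<and> r' \<le> r \<longrightarrow> d \<le> e"
    and attractive: "\<And>r e. \<lbrakk>r \<ge> 0; e > 0\<rbrakk> \<Longrightarrow> \<exists>s\<^sub>0. \<forall>r' s d. Q r' s d \<and> r' \<le> r \<and> s \<ge> s\<^sub>0 \<longrightarrow> d \<le> e"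
  obtains \<beta> where "class_KL \<beta>" "\<And>r s d. Q r s d \<Longrightarrow> d \<le> \<beta> r s"
proof
  define D where "D r s = insert 0 {d. \<exists>r' s'. Q r' s' d \<and> r' \<le> r \<and> s' \<ge> s}" for r s
  define \<beta> where "\<beta> r s = Sup (D r s)" for r s
  have bdd: "bdd_above (D r s)" if "r \<ge> 0" for r s
  proof -
    obtain B where "\<forall>r' s d. Q r' s d \<and> r' \<le> r \<longrightarrow> d \<le> B" using bounded[OF \<open>r \<ge> 0\<close>] by blast
    then show ?thesis unfolding D_def bdd_above_def by (intro exI[of _ "max B 0"]) fastforce
  qed
  have ub: "d \<le> \<beta> r s" if "d \<in> D r s" "r \<ge> 0" for d r s
    unfolding \<beta>_def using that bdd by (intro cSup_upper)
  have le: "\<beta> r s \<le> e" if "e \<ge> 0" "\<And>r' s' d. Q r' s' d \<Longrightarrow> r' \<le> r \<Longrightarrow> s' \<ge> s \<Longrightarrow> d \<le> e" for r s e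
    unfolding \<beta>_def using that by (intro cSup_least) (auto simp: D_def)
  have pos: "\<beta> r s \<ge> 0" if "r \<ge> 0" for r s
    using that by (intro ub) (auto simp: D_def)
  have mono: "\<beta> r s \<le> \<beta> r' s'" if "0 \<le> r" "r \<le> r'" "s' \<le> s" for r r' s s'
    unfolding \<beta>_def using that bdd[of r' s'] by (intro cSup_subset_mono) (auto simp: D_def intro: order_trans)
  show "d \<le> \<beta> r s" if "Q r s d" for r s d
    using that nonneg[OF that] by (intro ub) (auto simp: D_def)
  show "class_KL \<beta>"
    unfolding class_KL_def
  proof (intro conjI allI impI)
    fix s :: real assume "s \<ge> 0"
    show "((\<lambda>r. \<beta> r s) \<longlongrightarrow> 0) (at_right 0)"
    proof (rule tendstoI)
      fix e :: real assume "e > 0"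
      then obtain r where r: "r > 0" "\<forall>r' s d. Q r' s d \<and> r' \<le> r \<longrightarrow> d \<le> e / 2"
        using stable[of "e / 2"] by auto
      have "dist (\<beta> r' s) 0 < e" if "r' \<in> {0<..<r}" for r'
      proof -
        have "\<beta> r' s \<le> e / 2"
        proof (rule le)
          fix r'' s' d assume "Q r'' s' d" "r'' \<le> r'"
          then show "d \<le> e / 2" using r(2) that by (meson greaterThanLessThan_iff less_imp_le order_trans)
        qed (use \<open>e > 0\<close> in simp)
        then show ?thesis using pos[of r' s] that \<open>e > 0\<close> by (simp add: dist_real_def)
      qed
      then show "\<forall>\<^sub>F r in at_right 0. dist (\<beta> r s) 0 < e"
        using eventually_at_right_real[OF r(1)] by (auto elim: eventually_mono)
    qed
  next
    fix r :: real assume "r \<ge> 0"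
    show "(\<beta> r \<longlongrightarrow> 0) at_top"
    proof (rule tendstoI)
      fix e :: real assume "e > 0"
      then obtain s0 where s0: "\<forall>r' s d. Q r' s d \<and> r' \<le> r \<and> s \<ge> s0 \<longrightarrow> d \<le> e / 2"
        using attractive[OF \<open>r \<ge> 0\<close>, of "e / 2"] by auto
      have "dist (\<beta> r s) 0 < e" if "s \<ge> s0" for s
      proof -
        have "\<beta> r s \<le> e / 2"
        proof (rule le)
          fix r' s' d assume "Q r' s' d" "r' \<le> r" "s' \<ge> s"
          then show "d \<le> e / 2" using s0 that by (meson order_trans)
        qed (use \<open>e > 0\<close> in simp)
        then show ?thesis using pos[OF \<open>r \<ge> 0\<close>, of s] \<open>e > 0\<close> by (simp add: dist_real_def)
      qed
      then show "\<forall>\<^sub>F s in at_top. dist (\<beta> r s) 0 < e"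
        by (auto simp: eventually_at_top_linorder)
    qed
  qed (use pos mono in \<open>auto simp: monotone_on_def\<close>)
qed

section \<open>Decrease of the Lyapunov function along a mode\<close>

lemma le_square_plus_one: "(y::real) \<le> y\<^sup>2 + 1"
proof -
  have "0 \<le> (y - 1 / 2)\<^sup>2" by simp
  then show ?thesis by (simp add: power2_eq_square algebra_simps)
qed

text \<open>What the proof uses of the weighted norm functions: smoothness, homogeneity of degree \<open>p\<close>,
  and comparison with powers of the norm. The constant \<open>L\<close> bounds all modes at once.\<close>
locale switched_lyapunov =
  fixes N :: nat and A :: "nat \<Rightarrow> real^'n^'n" and b :: "nat \<Rightarrow> real^'n"
    and V W :: "real^'n \<Rightarrow> real" and G :: "real^'n \<Rightarrow> real^'n"
    and p \<eta> L m M c :: real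
  assumes p_gt_1: "p > 1" and eta: "0 < \<eta>" "\<eta> < 1"
    and GDERIV_V: "\<And>x. GDERIV V x :> G x"
    and cont_G: "continuous_on UNIV G" and cont_W: "continuous_on UNIV W"
    and V_scale: "\<And>s x. s \<ge> 0 \<Longrightarrow> V (s *\<^sub>R x) = s powr p * V x"
    and W_scale: "\<And>s x. s \<ge> 0 \<Longrightarrow> W (s *\<^sub>R x) = s powr p * W x"
    and G_scale: "\<And>s x. s > 0 \<Longrightarrow> G (s *\<^sub>R x) = s powr (p - 1) *\<^sub>R G x"
    and L_pos: "L > 0" and A_bound: "\<And>k v. k \<in> {1..N} \<Longrightarrow> norm (A k *v v) \<le> L * norm v"
    and b_bound: "\<And>k. k \<in> {1..N} \<Longrightarrow> norm (b k) \<le> L"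
    and m_pos: "m > 0" and V_lower: "\<And>x. m * norm x powr p \<le> V x"
    and M_pos: "M > 0" and V_upper: "\<And>x. V x \<le> M * norm x powr p"
    and c_pos: "c > 0" and W_lower: "\<And>x. c * V x \<le> W x"
begin

definition rate :: "nat \<Rightarrow> real^'n \<Rightarrow> real" where
  "rate k x = G x \<bullet> affine_mode A b k x"

definition is_arc :: "nat \<Rightarrow> real \<Rightarrow> real \<Rightarrow> (real \<Rightarrow> real^'n) \<Rightarrow> bool" where
  "is_arc k s t X \<longleftrightarrow>
     (\<forall>u\<in>{s..t}. (X has_vector_derivative affine_mode A b k (X u)) (at u within {s..t}))"

lemma is_arc_subset: "is_arc k s t X \<Longrightarrow> {s'..t'} \<subseteq> {s..t} \<Longrightarrow> is_arc k s' t' X"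
  unfolding is_arc_def by (meson has_vector_derivative_within_subset subsetD)

lemma V_nonneg: "V x \<ge> 0"
  by (rule order_trans[OF _ V_lower]) (use m_pos in simp)

lemma V_0: "V 0 = 0"
  using V_scale[of 0 0] by simp

lemma cont_V: "continuous_on S V"
  using GDERIV_V unfolding gderiv_def
  by (meson continuous_at_imp_continuous_on has_derivative_continuous)

text \<open>The exponential rate is \<open>\<eta> * c\<close>, since \<open>\<eta> * W \<ge> \<eta> * c * V\<close>.\<close>
lemma V_decay:
  assumes arc: "is_arc k s t X"
    and dec: "\<And>u. u \<in> {s<..<t} \<Longrightarrow> rate k (X u) \<le> - \<eta> * W (X u)" and u: "u \<in> {s..t}"
  shows "V (X u) \<le> exp (- (\<eta> * c) * (u - s)) * V (X s)"
proof -
  define g where "g v = V (X v) * exp (\<eta> * c * (v - s))" for v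
  define g' where "g' v = (rate k (X v) + \<eta> * c * V (X v)) * exp (\<eta> * c * (v - s))" for v
  have "g u \<le> g s"
  proof (rule decreasing_if_derivative_nonpos[OF _ _ u])
    fix v assume v: "v \<in> {s..t}"
    have "(X has_derivative (\<lambda>h. h *\<^sub>R affine_mode A b k (X v))) (at v within {s..t})"
      using arc v by (simp add: is_arc_def has_vector_derivative_def)
    then have "((\<lambda>v. V (X v)) has_derivative (\<lambda>h. (h *\<^sub>R affine_mode A b k (X v)) \<bullet> G (X v))) (at v within {s..t})"
      by (rule has_derivative_compose) (use GDERIV_V in \<open>simp add: gderiv_def\<close>)
    then have "((\<lambda>v. V (X v)) has_real_derivative rate k (X v)) (at v within {s..t})"
      unfolding has_field_derivative_def
      by (rule has_derivative_eq_rhs) (auto simp: rate_def inner_commute mult.commute)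
    then show "(g has_real_derivative g' v) (at v within {s..t})"
      unfolding g_def g'_def by (auto intro!: derivative_eq_intros simp: algebra_simps)
  next
    fix v assume "v \<in> {s<..<t}"
    then have "rate k (X v) \<le> - \<eta> * W (X v)" by (rule dec)
    moreover have "\<eta> * (c * V (X v)) \<le> \<eta> * W (X v)" using W_lower eta by simp
    ultimately show "g' v \<le> 0" by (simp add: g'_def mult_le_0_iff)
  qed
  then have "exp (- (\<eta> * c) * (u - s)) * g u \<le> exp (- (\<eta> * c) * (u - s)) * g s"
    by (intro mult_left_mono) auto
  also have "exp (- (\<eta> * c) * (u - s)) * g u = V (X u)"
    by (simp add: g_def exp_minus)
  finally show ?thesis by (simp add: g_def)
qed

text \<open>The neighbourhood is relative to \<open>norm x\<close>, so one \<open>\<rho>\<close> serves the unbounded region \<open>\<delta> \<le> norm x\<close>.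
  With \<open>r = 1 / norm x\<close>, the pair \<open>(r x, r)\<close> ranges over a compact set, and \<open>\<Phi> (r y, r)\<close> is \<open>rate k y + \<eta> * W y\<close> up to
  the factor \<open>r powr p\<close>. On the unit sphere \<open>W \<ge> c * m\<close>, so \<open>\<Phi>\<close> is at most \<open>- (1 - \<eta>) * (c * m)\<close> at the
  starting point, and uniform continuity keeps it negative nearby.\<close>
lemma strong_decrease_near:
  assumes k: "k \<in> {1..N}" and "\<delta> > 0"
  shows "\<exists>\<rho>>0. \<forall>x y. \<delta> \<le> norm x \<and> rate k x \<le> - W x \<and> norm (y - x) \<le> \<rho> * norm x
            \<longrightarrow> rate k y < - \<eta> * W y"
proof -
  define \<Phi> where "\<Phi> z = G (fst z) \<bullet> (A k *v fst z + snd z *\<^sub>R b k) + \<eta> * W (fst z)" for z :: "(real^'n) \<times> real"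
  define K where "K = cball (0::real^'n) 2 \<times> {0..1 / \<delta>}"
  have "continuous_on K \<Phi>"
    unfolding \<Phi>_def
    by (intro continuous_intros continuous_on_compose2[OF cont_G] continuous_on_compose2[OF cont_W]
        continuous_on_compose2[OF linear_continuous_on[OF matrix_vector_mul_bounded_linear[of "A k"], of UNIV]]) auto
  moreover have "compact K" unfolding K_def by (intro compact_Times) auto
  ultimately have uc: "uniformly_continuous_on K \<Phi>" by (rule compact_uniformly_continuous)
  have e: "(1 - \<eta>) * (c * m) > 0" using eta c_pos m_pos by simp
  obtain d where "d > 0" and d: "\<And>z z'. \<lbrakk>z \<in> K; z' \<in> K; dist z' z < d\<rbrakk> \<Longrightarrow> dist (\<Phi> z') (\<Phi> z) < (1 - \<eta>) * (c * m)"
    using uc e unfolding uniformly_continuous_on_def by meson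
  define \<rho> where "\<rho> = min 1 (d / 2)"
  have scale: "\<Phi> (r *\<^sub>R y, r) = r powr p * (rate k y + \<eta> * W y)" if "r > 0" for r y
  proof -
    have "A k *v (r *\<^sub>R y) + r *\<^sub>R b k = r *\<^sub>R affine_mode A b k y"
      by (simp add: affine_mode_def scaleR_right_distrib matrix_vector_mult_scaleR)
    moreover have "r powr (p - 1) * r = r powr p"
      using that by (simp add: powr_diff)
    ultimately show ?thesis
      using that by (simp add: \<Phi>_def G_scale W_scale rate_def algebra_simps)
  qed
  show ?thesis
  proof (intro exI conjI allI impI)
    show "\<rho> > 0" using \<open>d > 0\<close> by (simp add: \<rho>_def)
    fix x y assume asm: "\<delta> \<le> norm x \<and> rate k x \<le> - W x \<and> norm (y - x) \<le> \<rho> * norm x"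
    then have x: "norm x > 0" using \<open>\<delta> > 0\<close> by linarith
    define r where "r = 1 / norm x"
    have r: "r > 0" "r * norm x = 1" "r \<le> 1 / \<delta>"
      using x asm \<open>\<delta> > 0\<close> by (auto simp: r_def field_simps)
    have nx: "norm (r *\<^sub>R x) = 1" using r by simp
    have "norm (r *\<^sub>R y - r *\<^sub>R x) = r * norm (y - x)"
      using r by (simp flip: scaleR_right_diff_distrib)
    also have "\<dots> \<le> r * (\<rho> * norm x)" using asm r by simp
    also have "\<dots> = \<rho>" using r(2) by (simp add: mult.left_commute mult.commute)
    finally have yx: "norm (r *\<^sub>R y - r *\<^sub>R x) \<le> \<rho>" .
    then have ny: "norm (r *\<^sub>R y) \<le> 2"
      using nx norm_triangle_sub[of "r *\<^sub>R y" "r *\<^sub>R x"] by (simp add: \<rho>_def)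
    have "dist (r *\<^sub>R y, r) (r *\<^sub>R x, r) < d"
      using yx \<open>d > 0\<close> by (simp add: dist_Pair_Pair dist_norm \<rho>_def)
    then have "\<Phi> (r *\<^sub>R y, r) < \<Phi> (r *\<^sub>R x, r) + (1 - \<eta>) * (c * m)"
      using d[of "(r *\<^sub>R x, r)" "(r *\<^sub>R y, r)"] nx ny r by (simp add: K_def dist_real_def)
    also have "\<Phi> (r *\<^sub>R x, r) \<le> - ((1 - \<eta>) * (c * m))"
    proof -
      have "c * m \<le> c * V (r *\<^sub>R x)" using V_lower[of "r *\<^sub>R x"] nx c_pos by simp
      also have "\<dots> \<le> W (r *\<^sub>R x)" by (rule W_lower)
      also have "\<dots> = r powr p * W x" using r W_scale by simp
      finally have 1: "(1 - \<eta>) * (c * m) \<le> (1 - \<eta>) * (r powr p * W x)"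
        using eta by (intro mult_left_mono) auto
      have "r powr p * rate k x \<le> r powr p * (- W x)" using asm by (intro mult_left_mono) auto
      with 1 show ?thesis by (simp add: scale[OF r(1)] algebra_simps)
    qed
    finally have "r powr p * (rate k y + \<eta> * W y) < 0" using scale[OF r(1)] by simp
    moreover have "r powr p > 0" using r by simp
    ultimately show "rate k y < - \<eta> * W y" by (simp add: mult_less_0_iff)
  qed
qed

lemma arc_growth:
  assumes "k \<in> {1..N}" "is_arc k s t X" "u \<in> {s..t}"
  shows "(norm (X u))\<^sup>2 + 1 \<le> ((norm (X s))\<^sup>2 + 1) * exp (3 * L * (u - s))"
  by (rule affine_growth[of s t X "A k" "b k"])
     (use assms A_bound b_bound in \<open>auto simp: is_arc_def affine_mode_def\<close>)

lemma arc_displacement: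
  assumes "k \<in> {1..N}" "is_arc k s t X" "u \<in> {s..t}" "u - s \<le> 1" "norm (X s) \<le> B"
  shows "norm (X u) \<le> (B\<^sup>2 + 1) * exp (3 * L)"
    and "norm (X u - X s) \<le> L * ((B\<^sup>2 + 1) * exp (3 * L) + 1) * (u - s)"
proof -
  have *: "norm (X v) \<le> (B\<^sup>2 + 1) * exp (3 * L)" if "v \<in> {s..u}" for v
  proof -
    have "norm (X v) \<le> (norm (X v))\<^sup>2 + 1" by (rule le_square_plus_one)
    also have "\<dots> \<le> ((norm (X s))\<^sup>2 + 1) * exp (3 * L * (v - s))"
      using assms that by (intro arc_growth) auto
    also have "\<dots> \<le> (B\<^sup>2 + 1) * exp (3 * L)"
      using assms that L_pos by (intro mult_mono) (auto intro!: power_mono)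
    finally show ?thesis .
  qed
  then show "norm (X u) \<le> (B\<^sup>2 + 1) * exp (3 * L)" using assms by auto
  show "norm (X u - X s) \<le> L * ((B\<^sup>2 + 1) * exp (3 * L) + 1) * (u - s)"
    by (rule affine_displacement[of s u X "A k" "b k"])
       (use assms A_bound b_bound * is_arc_subset[OF assms(2), of s u] in \<open>auto simp: is_arc_def affine_mode_def\<close>)
qed

text \<open>Dividing an arc by the norm of its starting point gives an arc from the unit sphere whose affine part
  is bounded by \<open>L / \<delta>\<close>; its displacement in a short time is therefore uniformly small.\<close>
lemma arc_relative_displacement:
  assumes "\<delta> > 0" "\<rho> > 0"
  shows "\<exists>h>0. \<forall>k\<in>{1..N}. \<forall>s t X u. is_arc k s t X \<and> \<delta> \<le> norm (X s) \<and> u \<in> {s..t} \<and> u - s \<le> h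
            \<longrightarrow> norm (X u - X s) \<le> \<rho> * norm (X s)"
proof -
  define L' where "L' = L * (1 + 1 / \<delta>)"
  define K where "K = 2 * exp (3 * L')"
  define h where "h = min 1 (\<rho> / (L' * (K + 1)))"
  have L': "L' > 0" "L \<le> L'" "L / \<delta> \<le> L'" using L_pos \<open>\<delta> > 0\<close> by (auto simp: L'_def algebra_simps add_pos_pos)
  have "K > 0" by (simp add: K_def)
  show ?thesis
  proof (intro exI conjI ballI allI impI)
    show "h > 0" using L' \<open>K > 0\<close> \<open>\<rho> > 0\<close> by (simp add: h_def)
    fix k s t X u assume k: "k \<in> {1..N}"
      and asm: "is_arc k s t X \<and> \<delta> \<le> norm (X s) \<and> u \<in> {s..t} \<and> u - s \<le> h"
    then have arc: "is_arc k s u X" using is_arc_subset[of k s t X s u] by auto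
    define r where "r = 1 / norm (X s)"
    have x: "norm (X s) > 0" using asm \<open>\<delta> > 0\<close> by linarith
    have r: "r > 0" "r * norm (X s) = 1" "r \<le> 1 / \<delta>"
      using x asm \<open>\<delta> > 0\<close> by (auto simp: r_def field_simps)
    define Y where "Y v = r *\<^sub>R X v" for v
    have der: "(Y has_vector_derivative (A k *v Y v + r *\<^sub>R b k)) (at v within {s..u})" if "v \<in> {s..u}" for v
    proof -
      have "(Y has_vector_derivative (r *\<^sub>R affine_mode A b k (X v))) (at v within {s..u})"
        unfolding Y_def using arc that 
        by (intro bounded_linear.has_vector_derivative[OF bounded_linear_scaleR_right]) (simp add: is_arc_def)
      then show ?thesis
        by (simp add: Y_def affine_mode_def scaleR_right_distrib matrix_vector_mult_scaleR)
    qed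
    have A: "norm (A k *v v) \<le> L' * norm v" for v
      using A_bound[OF k, of v] L'(2) mult_right_mono[OF L'(2), of "norm v"] by simp
    have "norm (r *\<^sub>R b k) \<le> (1 / \<delta>) * L"
      using mult_mono[OF r(3) b_bound[OF k]] r(1) \<open>\<delta> > 0\<close> by simp
    then have bb: "norm (r *\<^sub>R b k) \<le> L'" using L'(3) by simp
    have Ys: "norm (Y s) = 1" using r by (simp add: Y_def)
    have YK: "norm (Y v) \<le> K" if "v \<in> {s..u}" for v
    proof -
      have "norm (Y v) \<le> (norm (Y v))\<^sup>2 + 1" by (rule le_square_plus_one)
      also have "\<dots> \<le> ((norm (Y s))\<^sup>2 + 1) * exp (3 * L' * (v - s))"
        by (rule affine_growth[OF der A bb that])
      also have "\<dots> \<le> K"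
        using that asm L' Ys by (simp add: K_def h_def)
      finally show ?thesis .
    qed
    have "norm (Y u - Y s) \<le> L' * (K + 1) * (u - s)"
      using asm by (intro affine_displacement[OF der A bb _ YK]) auto
    also have "\<dots> \<le> L' * (K + 1) * (\<rho> / (L' * (K + 1)))"
      using asm L' \<open>K > 0\<close> by (intro mult_left_mono) (auto simp: h_def)
    also have "\<dots> = \<rho>" using L' \<open>K > 0\<close> by simp
    finally have "norm (Y u - Y s) \<le> \<rho>" .
    moreover have "norm (Y u - Y s) = r * norm (X u - X s)"
      using r by (simp add: Y_def flip: scaleR_right_diff_distrib)
    ultimately show "norm (X u - X s) \<le> \<rho> * norm (X s)"
      using x by (simp add: r_def field_simps)
  qed
qed

text \<open>An arc that starts in the best mode, outside the ball of radius \<open>\<delta>\<close>, cannot reach the jump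
  region before time \<open>h\<close> has passed.\<close>
definition dwell :: "real \<Rightarrow> real \<Rightarrow> bool" where
  "dwell \<delta> h \<longleftrightarrow> (\<forall>k\<in>{1..N}. \<forall>s t X u.
     is_arc k s t X \<and> \<delta> \<le> norm (X s) \<and> rate k (X s) \<le> - W (X s) \<and> u \<in> {s..t} \<and> u - s \<le> h
       \<longrightarrow> rate k (X u) < - \<eta> * W (X u))"

lemma dwellD:
  "\<lbrakk>dwell \<delta> h; k \<in> {1..N}; is_arc k s t X; \<delta> \<le> norm (X s); rate k (X s) \<le> - W (X s);
    u \<in> {s..t}; u - s \<le> h\<rbrakk> \<Longrightarrow> rate k (X u) < - \<eta> * W (X u)"
  unfolding dwell_def by blast

lemma dwell_mono: "dwell \<delta> h \<Longrightarrow> \<delta> \<le> \<delta>' \<Longrightarrow> h' \<le> h \<Longrightarrow> dwell \<delta>' h'"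
  unfolding dwell_def by (meson order_trans)

lemma dwell_exists:
  assumes "\<delta> > 0"
  shows "\<exists>h>0. dwell \<delta> h"
proof -
  obtain \<rho> where \<rho>: "\<And>k. k \<in> {1..N} \<Longrightarrow> \<rho> k > 0 \<and> (\<forall>x y. \<delta> \<le> norm x \<and> rate k x \<le> - W x
      \<and> norm (y - x) \<le> \<rho> k * norm x \<longrightarrow> rate k y < - \<eta> * W y)"
    using strong_decrease_near[OF _ assms] by metis
  define \<rho>0 where "\<rho>0 = Min (insert 1 (\<rho> ` {1..N}))"
  have \<rho>0: "\<rho>0 > 0" "\<And>k. k \<in> {1..N} \<Longrightarrow> \<rho>0 \<le> \<rho> k"
    using \<rho> unfolding \<rho>0_def by (simp, intro Min_le) auto
  obtain h where "h > 0" and h: "\<And>k s t X u. \<lbrakk>k \<in> {1..N}; is_arc k s t X; \<delta> \<le> norm (X s); u \<in> {s..t}; u - s \<le> h\<rbrakk>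
            \<Longrightarrow> norm (X u - X s) \<le> \<rho>0 * norm (X s)"
    using arc_relative_displacement[OF assms \<rho>0(1)] by meson
  have "dwell \<delta> h"
    unfolding dwell_def
  proof (intro ballI allI impI)
    fix k s t X u assume k: "k \<in> {1..N}"
      and asm: "is_arc k s t X \<and> \<delta> \<le> norm (X s) \<and> rate k (X s) \<le> - W (X s) \<and> u \<in> {s..t} \<and> u - s \<le> h"
    then have "norm (X u - X s) \<le> \<rho>0 * norm (X s)" by (intro h[of k s t]) auto
    also have "\<dots> \<le> \<rho> k * norm (X s)" using \<rho>0(2)[OF k] by (intro mult_right_mono) auto
    finally show "rate k (X u) < - \<eta> * W (X u)" using \<rho>[OF k] asm by blast
  qed
  with \<open>h > 0\<close> show ?thesis by blast
qed

end

context switched_lyapunov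
begin

section \<open>The level that belongs to a timer period\<close>

text \<open>The summand \<open>T\<close> has two purposes: it makes \<open>radius\<close> strictly increasing, and it lifts it above the
  infimum, which need not be attained.\<close>
definition radius :: "real \<Rightarrow> real" where
  "radius T = Inf {\<delta>. \<delta> > 0 \<and> dwell \<delta> T} + T"

text \<open>By \<open>arc_growth\<close>, the square of the norm at time \<open>T\<close> is at most the base of the power, if the arc starts in the
  ball of radius \<open>radius T\<close>.\<close>
definition level :: "real \<Rightarrow> real" where
  "level T = M * (((radius T)\<^sup>2 + 1) * exp (3 * L * T) - 1) powr (p / 2)"

lemma radius_properties:
  assumes "dwell 1 TM" "0 < T" "T \<le> TM"
  shows "dwell (radius T) T" "T \<le> radius T" "radius T \<le> 1 + T"
proof -
  let ?D = "{\<delta>. \<delta> > 0 \<and> dwell \<delta> T}"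
  have 1: "1 \<in> ?D" using assms dwell_mono by auto
  have bdd: "bdd_below ?D" by (auto intro: bdd_belowI[of _ 0])
  show "T \<le> radius T" unfolding radius_def using 1 by (auto intro!: cInf_greatest)
  show "radius T \<le> 1 + T" unfolding radius_def using cInf_lower[OF 1 bdd] by simp
  obtain \<delta> where "\<delta> \<in> ?D" "\<delta> < radius T"
    using cInf_lessD[of ?D "radius T"] 1 \<open>0 < T\<close> by (force simp: radius_def)
  then show "dwell (radius T) T" using dwell_mono[of \<delta> T "radius T" T] by auto
qed

lemma radius_strict_mono:
  assumes "dwell 1 TM" "0 < T" "T < T'" "T' \<le> TM"
  shows "radius T < radius T'"
proof -
  have "Inf {\<delta>. \<delta> > 0 \<and> dwell \<delta> T} \<le> Inf {\<delta>. \<delta> > 0 \<and> dwell \<delta> T'}"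
  proof (rule cInf_superset_mono)
    show "{\<delta>. \<delta> > 0 \<and> dwell \<delta> T'} \<noteq> {}" 
      using assms dwell_mono[of 1 TM 1 T'] by (auto intro!: exI[of _ 1])
    show "bdd_below {\<delta>. \<delta> > 0 \<and> dwell \<delta> T}" by (auto intro: bdd_belowI[of _ 0])
    show "{\<delta>. \<delta> > 0 \<and> dwell \<delta> T'} \<subseteq> {\<delta>. \<delta> > 0 \<and> dwell \<delta> T}"
      using assms dwell_mono by auto
  qed
  then show ?thesis using assms by (simp add: radius_def)
qed

lemma radius_tendsto: 
  assumes "dwell 1 TM" "TM > 0"
  shows "(radius \<longlongrightarrow> 0) (at_right 0)"
proof (rule tendstoI)
  fix e :: real assume "e > 0"
  then obtain h where h: "h > 0" "dwell (e / 2) h" using dwell_exists[of "e / 2"] by auto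
  define T0 where "T0 = min h (min (e / 2) TM)"
  have "T0 > 0" using h \<open>e > 0\<close> assms by (simp add: T0_def)
  have "dist (radius T) 0 < e" if "T \<in> {0<..<T0}" for T
  proof -
    have "e / 2 \<in> {\<delta>. \<delta> > 0 \<and> dwell \<delta> T}"
      using h that \<open>e > 0\<close> dwell_mono[of "e / 2" h "e / 2" T] by (auto simp: T0_def)
    then have "Inf {\<delta>. \<delta> > 0 \<and> dwell \<delta> T} \<le> e / 2"
      by (rule cInf_lower) (auto intro: bdd_belowI[of _ 0])
    then have "radius T < e" using that by (simp add: radius_def T0_def)
    moreover have "radius T \<ge> 0"
      using radius_properties(2)[OF assms(1), of T] that by (simp add: T0_def)
    ultimately show ?thesis by (simp add: dist_real_def)
  qed
  then show "\<forall>\<^sub>F T in at_right 0. dist (radius T) 0 < e"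
    using eventually_at_right_real[OF \<open>T0 > 0\<close>] by (auto elim: eventually_mono)
qed

lemma level_pos:
  assumes "dwell 1 TM" "0 < T" "T \<le> TM"
  shows "level T > 0"
proof -
  have "radius T > 0" using radius_properties[OF assms] assms by simp
  then have "1 * 1 < ((radius T)\<^sup>2 + 1) * exp (3 * L * T)"
    using assms L_pos by (intro mult_strict_mono) (auto intro: add_nonneg_pos)
  then show ?thesis using M_pos by (simp add: level_def)
qed

lemma level_strict_mono:
  assumes "dwell 1 TM" "0 < T" "T < T'" "T' \<le> TM"
  shows "level T < level T'"
proof -
  have r: "0 < radius T" "radius T < radius T'"
    using radius_properties[OF assms(1,2)] radius_strict_mono[OF assms] assms by auto
  have "1 * 1 < ((radius T)\<^sup>2 + 1) * exp (3 * L * T)"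
    using r assms L_pos by (intro mult_strict_mono) (auto intro: add_nonneg_pos)
  moreover have "((radius T)\<^sup>2 + 1) * exp (3 * L * T) < ((radius T')\<^sup>2 + 1) * exp (3 * L * T')"
    using r assms L_pos by (intro mult_strict_mono) (auto intro!: power_strict_mono add_nonneg_pos)
  ultimately show ?thesis
    using M_pos p_gt_1 unfolding level_def by (intro mult_strict_left_mono powr_less_mono2) auto
qed

lemma level_tendsto:
  assumes "dwell 1 TM" "TM > 0"
  shows "(level \<longlongrightarrow> 0) (at_right 0)"
proof -
  have T: "((\<lambda>T. T) \<longlongrightarrow> 0) (at_right (0::real))" by (rule tendsto_ident_at)
  have "((\<lambda>T. ((radius T)\<^sup>2 + 1) * exp (3 * L * T) - 1) \<longlongrightarrow> (0\<^sup>2 + 1) * exp (3 * L * 0) - 1) (at_right 0)"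
    by (intro tendsto_intros radius_tendsto[OF assms] T)
  then have lim: "((\<lambda>T. ((radius T)\<^sup>2 + 1) * exp (3 * L * T) - 1) \<longlongrightarrow> 0) (at_right 0)"
    by simp
  have "((\<lambda>T. (((radius T)\<^sup>2 + 1) * exp (3 * L * T) - 1) powr (p / 2)) \<longlongrightarrow> 0) (at_right 0)"
  proof (rule tendsto_zero_powrI[OF lim tendsto_const])
    have "0 \<le> ((radius T)\<^sup>2 + 1) * exp (3 * L * T) - 1" if "T \<in> {0<..<1}" for T
      using mult_mono[of 1 "(radius T)\<^sup>2 + 1" 1 "exp (3 * L * T)"] that L_pos by simp
    then show "\<forall>\<^sub>F T in at_right 0. 0 \<le> ((radius T)\<^sup>2 + 1) * exp (3 * L * T) - 1"
      using eventually_at_right_real[of 0 1] by (auto elim: eventually_mono)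
  qed (use p_gt_1 in simp)
  from tendsto_mult_right_zero[OF this, of M] show ?thesis
    by (simp add: level_def[abs_def])
qed

lemma capture:
  assumes "k \<in> {1..N}" "is_arc k s t X" "u \<in> {s..t}" "u - s \<le> T" "norm (X s) \<le> radius T"
  shows "V (X u) \<le> level T"
proof -
  have "(norm (X u))\<^sup>2 + 1 \<le> ((norm (X s))\<^sup>2 + 1) * exp (3 * L * (u - s))"
    by (rule arc_growth) (use assms in auto)
  also have "\<dots> \<le> ((radius T)\<^sup>2 + 1) * exp (3 * L * T)"
    using assms L_pos by (intro mult_mono) (auto intro!: power_mono)
  finally have "(norm (X u))\<^sup>2 \<le> ((radius T)\<^sup>2 + 1) * exp (3 * L * T) - 1" by simp
  then have "((norm (X u))\<^sup>2) powr (p / 2) \<le> (((radius T)\<^sup>2 + 1) * exp (3 * L * T) - 1) powr (p / 2)"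
    using p_gt_1 by (intro powr_mono2) auto
  moreover have "((norm (X u))\<^sup>2) powr (p / 2) = norm (X u) powr p"
    by (simp add: powr_powr flip: powr_numeral)
  ultimately have "M * norm (X u) powr p \<le> level T"
    using M_pos by (simp add: level_def)
  with V_upper[of "X u"] show ?thesis by linarith
qed

text \<open>The two cases meet exactly: outside the ball of radius \<open>radius T\<close> the dwell time covers the whole timer
  period, inside it \<open>capture\<close> does. After the timer period the decrease is given by \<open>dec\<close>.\<close>
lemma phase_estimate:
  assumes k: "k \<in> {1..N}" and dw: "dwell (radius T) T" and arc: "is_arc k s t X"
    and start: "rate k (X s) \<le> - W (X s)"
    and dec: "\<And>u. \<lbrakk>u \<in> {s<..<t}; T < u - s\<rbrakk> \<Longrightarrow> rate k (X u) \<le> - \<eta> * W (X u)"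
    and u: "u \<in> {s..t}" and "T > 0"
  shows "V (X u) \<le> max (level T) (exp (- (\<eta> * c) * (u - s)) * V (X s))"
proof (cases "radius T \<le> norm (X s)")
  case True
  have "V (X u) \<le> exp (- (\<eta> * c) * (u - s)) * V (X s)"
  proof (rule V_decay[OF arc _ u])
    fix v assume v: "v \<in> {s<..<t}"
    show "rate k (X v) \<le> - \<eta> * W (X v)"
    proof (cases "v - s \<le> T")
      case T: True
      have "rate k (X v) < - \<eta> * W (X v)"
        using v T by (intro dwellD[OF dw k arc True start]) auto
      then show ?thesis by simp
    qed (use dec v in auto)
  qed
  then show ?thesis by simp
next
  case False
  show ?thesis
  proof (cases "u - s \<le> T")
    case True
    then have "V (X u) \<le> level T" using False by (intro capture[OF k arc u]) auto
    then show ?thesis by simp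
  next
    case u': False
    have "V (X u) \<le> exp (- (\<eta> * c) * (u - (s + T))) * V (X (s + T))"
    proof (rule V_decay)
      show "is_arc k (s + T) t X" using \<open>T > 0\<close> by (intro is_arc_subset[OF arc]) auto
      show "rate k (X v) \<le> - \<eta> * W (X v)" if "v \<in> {s + T<..<t}" for v
        using that \<open>T > 0\<close> by (intro dec) auto
    qed (use u u' in auto)
    also have "\<dots> \<le> 1 * V (X (s + T))"
      using eta c_pos u' V_nonneg by (intro mult_right_mono) auto
    also have "\<dots> \<le> level T" using False u u' \<open>T > 0\<close> by (simp, intro capture[OF k arc]) auto
    finally show ?thesis by simp
  qed
qed

section \<open>Runs of the switched system\<close>

text \<open>The trace of a solution up to the end of phase \<open>J\<close>: phase \<open>j\<close> is the arc \<open>X j\<close> in mode \<open>k j\<close> on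
  \<open>{ts j..ts (Suc j)}\<close>. The timer occurs only through the time after which it enforces the flow region and
  admits a jump, which is \<open>\<Delta>\<close> in phase \<open>0\<close> and \<open>T\<close> in every phase that begins with a jump.\<close>
definition switching_run ::
  "real \<Rightarrow> real \<Rightarrow> nat \<Rightarrow> (nat \<Rightarrow> real) \<Rightarrow> (nat \<Rightarrow> nat) \<Rightarrow> (nat \<Rightarrow> real \<Rightarrow> real^'n) \<Rightarrow> bool" where
  "switching_run T \<Delta> J ts k X \<longleftrightarrow> ts 0 = 0 \<and>
     (\<forall>j\<le>J. k j \<in> {1..N} \<and> ts j \<le> ts (Suc j) \<and> is_arc (k j) (ts j) (ts (Suc j)) (X j) \<and>
        (\<forall>u\<in>{ts j<..<ts (Suc j)}. (if j = 0 then \<Delta> else T) < u - ts j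
           \<longrightarrow> rate (k j) (X j u) \<le> - \<eta> * W (X j u))) \<and>
     (\<forall>j<J. (if j = 0 then \<Delta> else T) \<le> ts (Suc j) - ts j \<and>
        X (Suc j) (ts (Suc j)) = X j (ts (Suc j)) \<and>
        rate (k j) (X j (ts (Suc j))) \<ge> - \<eta> * W (X j (ts (Suc j))) \<and>
        rate (k (Suc j)) (X j (ts (Suc j))) \<le> - W (X j (ts (Suc j))))"

lemma run_phase:
  assumes "switching_run T \<Delta> J ts k X" "j \<le> J"
  shows "k j \<in> {1..N}" "ts j \<le> ts (Suc j)" "is_arc (k j) (ts j) (ts (Suc j)) (X j)"
    and "\<And>u. \<lbrakk>u \<in> {ts j<..<ts (Suc j)}; (if j = 0 then \<Delta> else T) < u - ts j\<rbrakk>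
           \<Longrightarrow> rate (k j) (X j u) \<le> - \<eta> * W (X j u)"
proof -
  note * = assms(1)[unfolded switching_run_def, THEN conjunct2, THEN conjunct1, THEN spec, THEN mp, OF assms(2)]
  show "k j \<in> {1..N}" by (rule *[THEN conjunct1])
  show "ts j \<le> ts (Suc j)" by (rule *[THEN conjunct2, THEN conjunct1])
  show "is_arc (k j) (ts j) (ts (Suc j)) (X j)"
    by (rule *[THEN conjunct2, THEN conjunct2, THEN conjunct1])
  show "rate (k j) (X j u) \<le> - \<eta> * W (X j u)"
    if "u \<in> {ts j<..<ts (Suc j)}" "(if j = 0 then \<Delta> else T) < u - ts j" for u
    by (rule *[THEN conjunct2, THEN conjunct2, THEN conjunct2, THEN bspec, OF that(1), THEN mp, OF that(2)])
qed

lemma run_jump: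
  assumes "switching_run T \<Delta> J ts k X" "j < J"
  shows "(if j = 0 then \<Delta> else T) \<le> ts (Suc j) - ts j"
    and "X (Suc j) (ts (Suc j)) = X j (ts (Suc j))"
    and "rate (k j) (X j (ts (Suc j))) \<ge> - \<eta> * W (X j (ts (Suc j)))"
    and "rate (k (Suc j)) (X (Suc j) (ts (Suc j))) \<le> - W (X (Suc j) (ts (Suc j)))"
proof -
  note * = assms(1)[unfolded switching_run_def, THEN conjunct2, THEN conjunct2, THEN spec, THEN mp, OF assms(2)]
  show "(if j = 0 then \<Delta> else T) \<le> ts (Suc j) - ts j" by (rule *[THEN conjunct1])
  show X: "X (Suc j) (ts (Suc j)) = X j (ts (Suc j))" by (rule *[THEN conjunct2, THEN conjunct1])
  show "rate (k j) (X j (ts (Suc j))) \<ge> - \<eta> * W (X j (ts (Suc j)))"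
    by (rule *[THEN conjunct2, THEN conjunct2, THEN conjunct1])
  show "rate (k (Suc j)) (X (Suc j) (ts (Suc j))) \<le> - W (X (Suc j) (ts (Suc j)))"
    unfolding X by (rule *[THEN conjunct2, THEN conjunct2, THEN conjunct2])
qed

lemma run_dwell_time:
  assumes run: "switching_run T \<Delta> J ts k X" and "\<And>j. \<lbrakk>1 \<le> j; j < J\<rbrakk> \<Longrightarrow> h \<le> ts (Suc j) - ts j" "h \<ge> 0"
  shows "(real J - 1) * h \<le> ts (Suc J)"
proof -
  have *: "real j * h \<le> ts (Suc j)" if "j < J" for j
    using that
  proof (induction j)
    case 0
    then show ?case using run_phase(2)[OF run, of 0] run by (simp add: switching_run_def)
  next
    case (Suc j)
    then show ?case using assms(2)[of "Suc j"] by (simp add: algebra_simps)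
  qed
  show ?thesis
  proof (cases J)
    case 0
    then show ?thesis using run_phase(2)[OF run, of 0] run \<open>h \<ge> 0\<close> by (simp add: switching_run_def)
  next
    case (Suc i)
    then show ?thesis using *[of i] run_phase(2)[OF run, of J] by simp
  qed
qed

text \<open>The bound \<open>max (level T) (C * exp (- (\<eta> * c) * u))\<close> decreases in \<open>u\<close> at the rate that \<open>phase_estimate\<close>
  gives, so it is passed on from phase to phase.\<close>
lemma run_propagate:
  assumes run: "switching_run T \<Delta> J ts k X" and dw: "dwell (radius T) T" and "T > 0"
    and "1 \<le> i" "i \<le> j" "j \<le> J" "C \<ge> 0"
    and start: "V (X i (ts i)) \<le> max (level T) (C * exp (- (\<eta> * c) * ts i))"
    and u: "u \<in> {ts j..ts (Suc j)}"
  shows "V (X j u) \<le> max (level T) (C * exp (- (\<eta> * c) * u))"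
proof -
  have phase_bound: "V (X j u) \<le> max (level T) (C * exp (- (\<eta> * c) * u))"
    if j: "1 \<le> j" "j \<le> J" and V: "V (X j (ts j)) \<le> max (level T) (C * exp (- (\<eta> * c) * ts j))"
      and u: "u \<in> {ts j..ts (Suc j)}" for j u
  proof -
    obtain j' where j': "j = Suc j'" using j(1) by (cases j) auto
    have "V (X j u) \<le> max (level T) (exp (- (\<eta> * c) * (u - ts j)) * V (X j (ts j)))"
    proof (rule phase_estimate[OF run_phase(1)[OF run j(2)] dw run_phase(3)[OF run j(2)] _ _ u \<open>T > 0\<close>])
      show "rate (k j) (X j (ts j)) \<le> - W (X j (ts j))"
        using run_jump(4)[OF run, of j'] j j' by simp
      show "rate (k j) (X j u) \<le> - \<eta> * W (X j u)" if "u \<in> {ts j<..<ts (Suc j)}" "T < u - ts j" for u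
        using run_phase(4)[OF run j(2), of u] that j by simp
    qed
    also have "\<dots> \<le> max (level T) (C * exp (- (\<eta> * c) * u))"
    proof -
      let ?q = "exp (- (\<eta> * c) * (u - ts j))"
      have q: "0 \<le> ?q" "?q \<le> 1" using u eta c_pos by auto
      have "?q * V (X j (ts j)) \<le> max (level T) (C * exp (- (\<eta> * c) * u))"
      proof (cases "V (X j (ts j)) \<le> level T")
        case True
        then show ?thesis using mult_right_mono[OF q(2) V_nonneg[of "X j (ts j)"]] by simp
      next
        case False
        then have "?q * V (X j (ts j)) \<le> ?q * (C * exp (- (\<eta> * c) * ts j))"
          using V q(1) by (intro mult_left_mono) auto
        also have "\<dots> = C * exp (- (\<eta> * c) * u)"
          by (simp add: algebra_simps flip: exp_add)
        finally show ?thesis by simp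
      qed
      then show ?thesis by simp
    qed
    finally show ?thesis .
  qed
  have "V (X j (ts j)) \<le> max (level T) (C * exp (- (\<eta> * c) * ts j))"
    using \<open>i \<le> j\<close> \<open>j \<le> J\<close>
  proof (induction j rule: dec_induct)
    case base
    then show ?case using start by simp
  next
    case (step n)
    then have "V (X n (ts (Suc n))) \<le> max (level T) (C * exp (- (\<eta> * c) * ts (Suc n)))"
      using run_phase(2)[OF run, of n] \<open>1 \<le> i\<close> 
      by (intro phase_bound[of n, OF _ _ step.IH]) auto
    then show ?case using run_jump(2)[OF run, of n] step by simp
  qed
  with u show ?thesis using assms(4-6) by (intro phase_bound[of j, OF _ _ _ u]) auto
qed

lemma run_decay:
  assumes run: "switching_run T \<Delta> J ts k X" and dw: "dwell (radius T) T" and "T > 0"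
    and "0 \<le> \<Delta>" and late: "J \<noteq> 0 \<or> \<Delta> \<le> ts (Suc J)"
  shows "\<Delta> \<le> ts 1" "\<Delta> \<le> ts (Suc J)"
    and "V (X J (ts (Suc J))) \<le> max (level T) (exp (- (\<eta> * c) * (ts (Suc J) - \<Delta>)) * V (X 0 \<Delta>))"
proof -
  have ts0: "ts 0 = 0" using run by (simp add: switching_run_def)
  show \<Delta>: "\<Delta> \<le> ts 1"
    using late run_jump(1)[OF run, of 0] ts0 by (cases J) auto
  define C where "C = V (X 0 \<Delta>) * exp (\<eta> * c * \<Delta>)"
  have C: "C \<ge> 0" "C * exp (- (\<eta> * c) * u) = exp (- (\<eta> * c) * (u - \<Delta>)) * V (X 0 \<Delta>)" for u
    using V_nonneg by (simp_all add: C_def algebra_simps flip: exp_add)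
  have 0: "V (X 0 u) \<le> C * exp (- (\<eta> * c) * u)" if "u \<in> {\<Delta>..ts 1}" for u
    unfolding C(2)
  proof (rule V_decay[of "k 0"])
    show "is_arc (k 0) \<Delta> (ts 1) (X 0)"
      using run_phase(3)[OF run, of 0] ts0 \<open>0 \<le> \<Delta>\<close> by (auto intro: is_arc_subset)
    show "rate (k 0) (X 0 v) \<le> - \<eta> * W (X 0 v)" if "v \<in> {\<Delta><..<ts 1}" for v
      using run_phase(4)[OF run, of 0 v] that ts0 \<open>0 \<le> \<Delta>\<close> by simp
  qed fact
  show "\<Delta> \<le> ts (Suc J)"
  proof -
    have "ts 1 \<le> ts (Suc j)" if "j \<le> J" for j
      using that
    proof (induction j)
      case (Suc j)
      then show ?case using run_phase(2)[OF run, of "Suc j"] by simp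
    qed simp
    with \<Delta> show ?thesis by force
  qed
  show "V (X J (ts (Suc J))) \<le> max (level T) (exp (- (\<eta> * c) * (ts (Suc J) - \<Delta>)) * V (X 0 \<Delta>))"
  proof (cases "J = 0")
    case True
    then show ?thesis using 0[of "ts 1"] \<Delta> C by simp
  next
    case False
    have "V (X 1 (ts 1)) \<le> max (level T) (C * exp (- (\<eta> * c) * ts 1))"
      using 0[of "ts 1"] \<Delta> run_jump(2)[OF run, of 0] False by simp
    from run_propagate[OF run dw \<open>T > 0\<close> _ _ _ C(1) this, of J "ts (Suc J)"] False
    show ?thesis using run_phase(2)[OF run, of J] by (simp only: C(2)) simp
  qed
qed

text \<open>If the final value of \<open>V\<close> exceeds both \<open>level T\<close> and the bound of \<open>V\<close> on the ball of radius \<open>\<delta>\<close>, then by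
  \<open>run_propagate\<close> all earlier phases but the first also started outside that ball, and each of them
  lasted for at least the dwell time.\<close>
lemma run_jump_count:
  assumes run: "switching_run T \<Delta> J ts k X" and dwT: "dwell (radius T) T" and "T > 0"
    and dw: "dwell \<delta> h" and "h > 0"
    and far: "V (X J (ts (Suc J))) > level T" "V (X J (ts (Suc J))) > M * \<delta> powr p" "\<delta> > 0"
  shows "(real J - 1) * h \<le> ts (Suc J)"
proof (rule run_dwell_time[OF run])
  fix j assume j: "1 \<le> j" "j < J"
  have jJ: "j \<le> J" using j by simp
  define C where "C = V (X j (ts j)) * exp (\<eta> * c * ts j)"
  have C: "C \<ge> 0" "C * exp (- (\<eta> * c) * u) = exp (- (\<eta> * c) * (u - ts j)) * V (X j (ts j))" for u
    using V_nonneg by (simp_all add: C_def algebra_simps flip: exp_add)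
  have "ts j \<le> ts (Suc i)" if "j \<le> i" "i \<le> J" for i
    using that
  proof (induction i rule: dec_induct)
    case base
    then show ?case using run_phase(2)[OF run, of j] by simp
  next
    case (step n)
    then show ?case using run_phase(2)[OF run, of "Suc n"] by simp
  qed
  then have ts: "ts j \<le> ts (Suc J)" using jJ by simp
  have "V (X J (ts (Suc J))) \<le> max (level T) (C * exp (- (\<eta> * c) * ts (Suc J)))"
    using run_phase(2)[OF run, of J] j C(2)[of "ts j"]
    by (intro run_propagate[OF run dwT \<open>T > 0\<close> j(1) jJ _ C(1)]) auto
  moreover have "C * exp (- (\<eta> * c) * ts (Suc J)) \<le> 1 * V (X j (ts j))"
    unfolding C(2) using ts eta c_pos V_nonneg by (intro mult_right_mono) auto
  ultimately have "V (X J (ts (Suc J))) \<le> V (X j (ts j))" using far(1) by linarith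
  then have "M * \<delta> powr p < M * norm (X j (ts j)) powr p" using far(2) V_upper[of "X j (ts j)"] by linarith
  then have "\<delta> \<le> norm (X j (ts j))"
    using M_pos p_gt_1 \<open>\<delta> > 0\<close> powr_mono2[of p "norm (X j (ts j))" \<delta>] by (force simp: not_le)
  show "h \<le> ts (Suc j) - ts j"
  proof (rule ccontr)
    assume "\<not> h \<le> ts (Suc j) - ts j"
    moreover obtain i where "j = Suc i" using j(1) by (cases j) auto
    then have "rate (k j) (X j (ts j)) \<le> - W (X j (ts j))" using run_jump(4)[OF run, of i] j by simp
    ultimately have "rate (k j) (X j (ts (Suc j))) < - \<eta> * W (X j (ts (Suc j)))"
      using run_phase(2)[OF run jJ]
      by (intro dwellD[OF dw run_phase(1)[OF run jJ] run_phase(3)[OF run jJ] \<open>\<delta> \<le> norm (X j (ts j))\<close>]) auto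
    with run_jump(3)[OF run j(2)] show False by simp
  qed
qed (use \<open>h > 0\<close> in simp)

end

context switched_lyapunov
begin

section \<open>Uniform estimates for all runs\<close>

definition sublevel :: "real \<Rightarrow> (real^'n) set" where
  "sublevel e = {x. V x \<le> e}"

lemma zero_in_sublevel: "e \<ge> 0 \<Longrightarrow> 0 \<in> sublevel e"
  by (simp add: sublevel_def V_0)

lemma closed_sublevel: "closed (sublevel e)"
  unfolding sublevel_def by (intro closed_Collect_le cont_V continuous_on_const)

lemma norm_le_of_V_le:
  assumes "V x \<le> v"
  shows "norm x \<le> (v / m) powr (1 / p)"
proof -
  have "norm x powr p \<le> v / m"
    using V_lower[of x] assms m_pos by (simp add: field_simps)
  then have "(norm x powr p) powr (1 / p) \<le> (v / m) powr (1 / p)"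
    using p_gt_1 by (intro powr_mono2) auto
  then show ?thesis using p_gt_1 by (simp add: powr_powr)
qed

lemma infdist_sublevel_le_norm: "e \<ge> 0 \<Longrightarrow> infdist x (sublevel e) \<le> norm x"
  using infdist_le[OF zero_in_sublevel, of e x] by simp

lemma norm_le_infdist_sublevel:
  assumes "e \<ge> 0" "e \<le> E"
  shows "norm x \<le> infdist x (sublevel e) + (E / m) powr (1 / p)"
proof -
  have "norm x - (E / m) powr (1 / p) \<le> infdist x (sublevel e)"
    using zero_in_sublevel[OF assms(1)] assms(2) norm_le_of_V_le
    by (intro infdist_ge_norm_minus) (auto simp: sublevel_def)
  then show ?thesis by simp
qed

text \<open>The distance \<open>d\<close> does not depend on the level, which may tend to zero with \<open>T\<close>. The function \<open>q\<close>, the \<open>p\<close>-th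
  root of \<open>V\<close>, is homogeneous of degree one and comparable to the norm. Shrinking \<open>y\<close> radially onto the sublevel set
  thus moves it by at most a constant times the excess of \<open>q\<close>, and the uniform continuity of \<open>q\<close> bounds this
  excess by the distance of \<open>x\<close>.\<close>
lemma sublevel_stability:
  assumes "E \<ge> 0" "e > 0"
  shows "\<exists>d>0. \<forall>\<epsilon> x y. 0 \<le> \<epsilon> \<and> \<epsilon> \<le> E \<and> infdist x (sublevel \<epsilon>) \<le> d \<and> V y \<le> max \<epsilon> (V x)
            \<longrightarrow> infdist y (sublevel \<epsilon>) \<le> e"
proof -
  define q where "q x = V x powr (1 / p)" for x
  define C where "C = m powr - (1 / p)"
  have "C > 0" using m_pos by (simp add: C_def)
  have nq: "norm x \<le> C * q x" for x
    using norm_le_of_V_le[of x "V x"] V_nonneg[of x] m_pos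
    by (simp add: q_def C_def powr_divide powr_minus field_simps)
  have q_mono: "q x \<le> \<epsilon> powr (1 / p)" if "V x \<le> \<epsilon>" for x \<epsilon>
    unfolding q_def using that V_nonneg p_gt_1 by (intro powr_mono2) auto
  define \<rho> where "\<rho> = (E / m) powr (1 / p)"
  have "continuous_on (cball 0 (\<rho> + 1)) q"
    unfolding q_def using V_nonneg p_gt_1 by (intro continuous_on_powr' cont_V continuous_on_const) auto
  then have uc: "uniformly_continuous_on (cball 0 (\<rho> + 1)) q"
    by (intro compact_uniformly_continuous) auto
  have "e / C > 0" using \<open>C > 0\<close> \<open>e > 0\<close> by simp
  then obtain d' where d': "d' > 0" "\<And>x x'. \<lbrakk>x \<in> cball 0 (\<rho> + 1); x' \<in> cball 0 (\<rho> + 1); dist x' x < d'\<rbrakk>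
      \<Longrightarrow> dist (q x') (q x) < e / C"
    using uc unfolding uniformly_continuous_on_def by meson
  define d where "d = min 1 (d' / 2)"
  show ?thesis
  proof (intro exI conjI allI impI)
    show "d > 0" using d' by (simp add: d_def)
    fix \<epsilon> x y
    assume asm: "0 \<le> \<epsilon> \<and> \<epsilon> \<le> E \<and> infdist x (sublevel \<epsilon>) \<le> d \<and> V y \<le> max \<epsilon> (V x)"
    show "infdist y (sublevel \<epsilon>) \<le> e"
    proof (cases "V y \<le> \<epsilon>")
      case True
      then show ?thesis using \<open>e > 0\<close> by (simp add: sublevel_def)
    next
      case False
      then have Vyx: "V y \<le> V x" "V y > 0" using asm by auto
      obtain x' where x': "x' \<in> sublevel \<epsilon>" "infdist x (sublevel \<epsilon>) = dist x x'"
        using infdist_attains_inf[OF closed_sublevel] zero_in_sublevel asm by (metis empty_iff)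
      have dxx: "dist x x' \<le> d" using x' asm by simp
      have "norm x' \<le> \<rho>"
        unfolding \<rho>_def using x'(1) asm by (intro norm_le_of_V_le) (auto simp: sublevel_def)
      moreover have "norm x \<le> norm x' + dist x x'"
        using norm_triangle_sub[of x x'] by (simp add: dist_norm)
      ultimately have "dist (q x') (q x) < e / C"
        using dxx d'(1) by (intro d'(2)) (auto simp: d_def dist_commute)
      moreover have "q x' \<le> \<epsilon> powr (1 / p)" using x' by (intro q_mono) (simp add: sublevel_def)
      ultimately have qx: "q x - \<epsilon> powr (1 / p) < e / C" by (simp add: dist_real_def)
      have qy: "q y \<le> q x" using q_mono[OF Vyx(1)] by (simp add: q_def)
      have qy0: "q y > 0" using Vyx by (simp add: q_def)
      define z where "z = (\<epsilon> powr (1 / p) / q y) *\<^sub>R y"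
      have "V z = (\<epsilon> powr (1 / p) / q y) powr p * V y"
        unfolding z_def using qy0 by (intro V_scale) auto
      also have "\<dots> = \<epsilon>"
        using Vyx asm p_gt_1 by (simp add: q_def powr_divide powr_powr)
      finally have "z \<in> sublevel \<epsilon>" by (simp add: sublevel_def)
      then have "infdist y (sublevel \<epsilon>) \<le> dist y z" by (rule infdist_le)
      also have "y - z = (1 - \<epsilon> powr (1 / p) / q y) *\<^sub>R y" by (simp add: z_def algebra_simps)
      then have "dist y z = \<bar>1 - \<epsilon> powr (1 / p) / q y\<bar> * norm y" by (simp add: dist_norm)
      also have "\<dots> \<le> \<bar>1 - \<epsilon> powr (1 / p) / q y\<bar> * (C * q y)"
        using nq by (intro mult_left_mono) auto
      also have "\<bar>1 - \<epsilon> powr (1 / p) / q y\<bar> = (q y - \<epsilon> powr (1 / p)) / q y"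
      proof -
        have "\<epsilon> powr (1 / p) \<le> q y"
          unfolding q_def using False asm p_gt_1 by (intro powr_mono2) auto
        then show ?thesis using qy0 by (simp add: field_simps)
      qed
      also have "(q y - \<epsilon> powr (1 / p)) / q y * (C * q y) = C * (q y - \<epsilon> powr (1 / p))"
        using qy0 by simp
      also have "\<dots> \<le> C * (e / C)" using qx qy \<open>C > 0\<close> by (intro mult_left_mono) auto
      also have "\<dots> = e" using \<open>C > 0\<close> by simp
      finally show ?thesis .
    qed
  qed
qed

text \<open>Initial size, hybrid time and final distance of all runs for all \<open>T < TM\<close> at once, so that the resulting
  comparison function does not depend on \<open>T\<close>.\<close>
definition run_triple :: "real \<Rightarrow> real \<Rightarrow> real \<Rightarrow> real \<Rightarrow> bool" where
  "run_triple TM r s d \<longleftrightarrow> (\<exists>T \<Delta> J ts k X. T \<in> {0<..<TM} \<and> 0 \<le> \<Delta> \<and> \<Delta> \<le> T \<and> switching_run T \<Delta> J ts k X \<and>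
     r = infdist (X 0 0) (sublevel (level T)) + \<Delta> \<and> s = ts (Suc J) + real J \<and>
     d = infdist (X J (ts (Suc J))) (sublevel (level T)))"

lemma run_triple_KL:
  assumes dwTM: "dwell 1 TM" and TM: "0 < TM" "TM \<le> 1"
  obtains \<beta> where "class_KL \<beta>" "\<And>r s d. run_triple TM r s d \<Longrightarrow> d \<le> \<beta> r s"
proof (rule class_KL_from_uniform_bounds[of "run_triple TM"])
  define E where "E = level TM"
  have level: "0 \<le> level T" "level T \<le> E" "dwell (radius T) T" if "T \<in> {0<..<TM}" for T
    using level_pos[OF dwTM, of T] level_strict_mono[OF dwTM, of T TM] radius_properties[OF dwTM, of T] that
    by (auto simp: E_def)
  have E: "E \<ge> 0" using level_pos[OF dwTM, of TM] TM by (simp add: E_def)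
  define Y where "Y r = (r + (E / m) powr (1 / p))" for r
  define K where "K r = ((Y r)\<^sup>2 + 1) * exp (3 * L)" for r
  have K_pos: "K r > 0" for r unfolding K_def by (intro mult_pos_pos add_nonneg_pos) auto
  have run0: "ts 0 = 0" "0 \<le> ts 1" "k 0 \<in> {1..N}" "is_arc (k 0) 0 (ts 1) (X 0)"
    if "switching_run T \<Delta> J ts k X" for T \<Delta> J ts k X
    using run_phase[OF that, of 0] that by (auto simp: switching_run_def)
  have early: "norm (X 0 u) \<le> K r" "norm (X 0 u - X 0 0) \<le> L * (K r + 1) * u"
    if "T \<in> {0<..<TM}" "switching_run T \<Delta> J ts k X" "\<Delta> \<le> T" "0 \<le> u" "u \<le> \<Delta>" "u \<le> ts 1"
      "infdist (X 0 0) (sublevel (level T)) + \<Delta> \<le> r" for T \<Delta> J ts k X u r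
  proof -
    have x0: "norm (X 0 0) \<le> Y r"
      using norm_le_infdist_sublevel[OF level(1,2)[OF that(1)], of "X 0 0"] that by (simp add: Y_def)
    show "norm (X 0 u) \<le> K r"
      unfolding K_def using that TM run0(3,4)[OF that(2)] x0
      by (intro arc_displacement(1)[of "k 0" 0 "ts 1"]) auto
    have "norm (X 0 u - X 0 0) \<le> L * (((Y r)\<^sup>2 + 1) * exp (3 * L) + 1) * (u - 0)"
      using that TM run0(3,4)[OF that(2)] x0
      by (intro arc_displacement(2)[of "k 0" 0 "ts 1"]) auto
    then show "norm (X 0 u - X 0 0) \<le> L * (K r + 1) * u" by (simp add: K_def)
  qed
  have VK: "V x \<le> M * K r powr p" if "norm x \<le> K r" for x r
  proof -
    have "norm x powr p \<le> K r powr p" using that p_gt_1 by (intro powr_mono2) auto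
    then show ?thesis using V_upper[of x] M_pos by (meson mult_left_mono less_imp_le order_trans)
  qed
  {
    fix r s d assume "run_triple TM r s d"
    then obtain T \<Delta> J ts k X where *: "T \<in> {0<..<TM}" "0 \<le> \<Delta>" "switching_run T \<Delta> J ts k X"
      "r = infdist (X 0 0) (sublevel (level T)) + \<Delta>" "s = ts (Suc J) + real J"
      "d = infdist (X J (ts (Suc J))) (sublevel (level T))"
      unfolding run_triple_def by blast
    have "0 \<le> ts (Suc J)"
      using run_dwell_time[OF *(3), of 0] run_phase(2)[OF *(3)] by simp
    then show "0 \<le> r \<and> 0 \<le> s \<and> 0 \<le> d" using * by (simp add: infdist_nonneg add_nonneg_nonneg)
  }
  \<comment> \<open>Boundedness: either the initial timer is still running, or \<open>run_decay\<close> applies.\<close>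
  show "\<exists>B. \<forall>r' s d. run_triple TM r' s d \<and> r' \<le> r \<longrightarrow> d \<le> B" if "r \<ge> 0" for r
  proof (intro exI allI impI)
    fix r' s d assume "run_triple TM r' s d \<and> r' \<le> r"
    then obtain T \<Delta> J ts k X where T: "T \<in> {0<..<TM}" and \<Delta>: "0 \<le> \<Delta>" "\<Delta> \<le> T"
      and run: "switching_run T \<Delta> J ts k X"
      and r: "infdist (X 0 0) (sublevel (level T)) + \<Delta> \<le> r"
      and d: "d = infdist (X J (ts (Suc J))) (sublevel (level T))"
      unfolding run_triple_def by blast
    show "d \<le> max (K r) ((max E (M * K r powr p) / m) powr (1 / p))"
    proof (cases "J \<noteq> 0 \<or> \<Delta> \<le> ts (Suc J)")
      case True
      note rd = run_decay[OF run level(3)[OF T] _ \<Delta>(1) True]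
      have "V (X 0 \<Delta>) \<le> M * K r powr p"
        using rd(1) T \<Delta> by (intro VK early(1)[OF T run \<Delta>(2) \<Delta>(1) _ _ r]) auto
      moreover have "exp (- (\<eta> * c) * (ts (Suc J) - \<Delta>)) * V (X 0 \<Delta>) \<le> 1 * V (X 0 \<Delta>)"
        using rd(2) T eta c_pos V_nonneg by (intro mult_right_mono) auto
      ultimately have "V (X J (ts (Suc J))) \<le> max E (M * K r powr p)"
        using rd(3) T level(2)[OF T] by simp
      then have "norm (X J (ts (Suc J))) \<le> (max E (M * K r powr p) / m) powr (1 / p)"
        by (rule norm_le_of_V_le)
      then show ?thesis unfolding d using infdist_sublevel_le_norm[OF level(1)[OF T], of "X J (ts (Suc J))"] by linarith
    next
      case False
      then have "norm (X J (ts (Suc J))) \<le> K r"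
        using run0(2)[OF run] by (simp, intro early(1)[OF T run \<Delta>(2) _ _ _ r]) auto
      then show ?thesis unfolding d using infdist_sublevel_le_norm[OF level(1)[OF T], of "X J (ts (Suc J))"] by linarith
    qed
  qed
  \<comment> \<open>Stability: the initial phase moves the state by at most \<open>L * (K 1 + 1) * \<Delta>\<close> with \<open>\<Delta> \<le> r\<close>, and
    from then on \<open>V\<close> is at most the maximum of the level and its value at time \<open>\<Delta>\<close>.\<close>
  show "\<exists>r>0. \<forall>r' s d. run_triple TM r' s d \<and> r' \<le> r \<longrightarrow> d \<le> e" if "e > 0" for e
  proof -
    obtain \<delta> where "\<delta> > 0" and \<delta>: "\<And>\<epsilon> x y. \<lbrakk>0 \<le> \<epsilon>; \<epsilon> \<le> E; infdist x (sublevel \<epsilon>) \<le> \<delta>; V y \<le> max \<epsilon> (V x)\<rbrakk>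
       \<Longrightarrow> infdist y (sublevel \<epsilon>) \<le> e"
      using sublevel_stability[OF E \<open>e > 0\<close>] by meson
    define Z where "Z = 1 + L * (K 1 + 1)"
    have Z: "Z > 0" using K_pos[of 1] L_pos by (simp add: Z_def add_pos_pos)
    define r where "r = min 1 (min \<delta> e / Z)"
    have r0: "r > 0" "r \<le> 1" "Z * r \<le> min \<delta> e"
      using \<open>\<delta> > 0\<close> \<open>e > 0\<close> Z by (auto simp: r_def min_def field_simps)
    have "d \<le> e" if Q: "run_triple TM r' s d" "r' \<le> r" for r' s d
    proof -
      obtain T \<Delta> J ts k X where T: "T \<in> {0<..<TM}" and \<Delta>: "0 \<le> \<Delta>" "\<Delta> \<le> T"
        and run: "switching_run T \<Delta> J ts k X"
        and r: "infdist (X 0 0) (sublevel (level T)) + \<Delta> \<le> r"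
        and d: "d = infdist (X J (ts (Suc J))) (sublevel (level T))"
        using Q unfolding run_triple_def by blast
      have r1: "infdist (X 0 0) (sublevel (level T)) + \<Delta> \<le> 1" using r r0 by simp
      have near: "infdist (X 0 u) (sublevel (level T)) \<le> min \<delta> e" if "0 \<le> u" "u \<le> \<Delta>" "u \<le> ts 1" for u
      proof -
        have "L * (K 1 + 1) * u \<le> L * (K 1 + 1) * r"
          using that r infdist_nonneg[of "X 0 0" "sublevel (level T)"] L_pos K_pos[of 1]
          by (intro mult_left_mono) auto
        then have "dist (X 0 u) (X 0 0) \<le> L * (K 1 + 1) * r"
          using early(2)[OF T run \<Delta>(2) that r1] by (simp add: dist_norm)
        moreover have "infdist (X 0 0) (sublevel (level T)) \<le> r" using r \<Delta> by simp
        moreover have "infdist (X 0 u) (sublevel (level T)) \<le> infdist (X 0 0) (sublevel (level T)) + dist (X 0 u) (X 0 0)"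
          by (rule infdist_triangle)
        ultimately have "infdist (X 0 u) (sublevel (level T)) \<le> Z * r" by (simp add: Z_def algebra_simps)
        then show ?thesis using r0 by simp
      qed
      show ?thesis
      proof (cases "J \<noteq> 0 \<or> \<Delta> \<le> ts (Suc J)")
        case True
        note rd = run_decay[OF run level(3)[OF T] _ \<Delta>(1) True]
        have "exp (- (\<eta> * c) * (ts (Suc J) - \<Delta>)) * V (X 0 \<Delta>) \<le> 1 * V (X 0 \<Delta>)"
          using rd(2) T eta c_pos V_nonneg by (intro mult_right_mono) auto
        then have "V (X J (ts (Suc J))) \<le> max (level T) (V (X 0 \<Delta>))" using rd(3) T by simp
        moreover have "infdist (X 0 \<Delta>) (sublevel (level T)) \<le> \<delta>" using near[of \<Delta>] rd(1) \<Delta> T by simp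
        ultimately show ?thesis unfolding d using level[OF T] by (intro \<delta>[of "level T" "X 0 \<Delta>"]) auto
      next
        case False
        then show ?thesis unfolding d using near[of "ts 1"] run0(2)[OF run] by auto
      qed
    qed
    then show ?thesis using r0(1) by blast
  qed
  \<comment> \<open>Attractivity: a distance above \<open>e\<close> means \<open>V > v\<close>; this bounds \<open>t\<close> by the exponential decay and then
    \<open>J\<close> by the dwell time \<open>h\<close> of the ball of radius \<open>\<delta>\<close>, on which \<open>V \<le> v\<close>.\<close>
  show "\<exists>s\<^sub>0. \<forall>r' s d. run_triple TM r' s d \<and> r' \<le> r \<and> s \<ge> s\<^sub>0 \<longrightarrow> d \<le> e" if "r \<ge> 0" "e > 0" for r e
  proof -
    define v where "v = m * e powr p"
    have v: "v > 0" using m_pos \<open>e > 0\<close> by (simp add: v_def)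
    define \<delta> where "\<delta> = (v / M) powr (1 / p)"
    have \<delta>: "\<delta> > 0" "M * \<delta> powr p = v"
      using v M_pos p_gt_1 by (simp_all add: \<delta>_def powr_powr)
    obtain h where h: "h > 0" "dwell \<delta> h" using dwell_exists[OF \<delta>(1)] by blast
    define U where "U = M * K r powr p"
    have "((\<lambda>t. exp (- (\<eta> * c) * (t - 1)) * U) \<longlongrightarrow> 0 * U) at_top"
    proof (intro tendsto_mult tendsto_const filterlim_compose[OF exp_at_bot])
      have "filterlim (\<lambda>t. t - 1) at_top (at_top :: real filter)"
        using filterlim_tendsto_add_at_top[OF tendsto_const[of "-1"] filterlim_ident] by simp
      then show "filterlim (\<lambda>t. - (\<eta> * c) * (t - 1)) at_bot at_top"
        using eta c_pos by (intro filterlim_tendsto_neg_mult_at_bot[OF tendsto_const]) auto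
    qed
    then have "\<forall>\<^sub>F t in at_top. exp (- (\<eta> * c) * (t - 1)) * U < v"
      using v by (intro order_tendstoD) auto
    then obtain t0 where t0: "\<And>t. t \<ge> t0 \<Longrightarrow> exp (- (\<eta> * c) * (t - 1)) * U < v"
      by (auto simp: eventually_at_top_linorder)
    define t1 where "t1 = max 1 t0"
    show ?thesis
    proof (intro exI[of _ "t1 + t1 / h + 1"] allI impI)
      fix r' s d assume Q: "run_triple TM r' s d \<and> r' \<le> r \<and> t1 + t1 / h + 1 \<le> s"
      then obtain T \<Delta> J ts k X where T: "T \<in> {0<..<TM}" and \<Delta>: "0 \<le> \<Delta>" "\<Delta> \<le> T"
        and run: "switching_run T \<Delta> J ts k X"
        and r: "infdist (X 0 0) (sublevel (level T)) + \<Delta> \<le> r"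
        and s: "s = ts (Suc J) + real J"
        and d: "d = infdist (X J (ts (Suc J))) (sublevel (level T))"
        unfolding run_triple_def by blast
      let ?x = "X J (ts (Suc J))"
      have T0: "T > 0" using T by simp
      show "d \<le> e"
      proof (rule ccontr)
        assume "\<not> d \<le> e"
        have big: "V ?x > level T"
        proof (rule ccontr)
          assume "\<not> V ?x > level T"
          then have "d = 0" unfolding d by (simp add: sublevel_def)
          with \<open>\<not> d \<le> e\<close> \<open>e > 0\<close> show False by simp
        qed
        have "norm ?x > e"
          using infdist_sublevel_le_norm[OF level(1)[OF T], of ?x] \<open>\<not> d \<le> e\<close> d by simp
        then have "e powr p < norm ?x powr p" using \<open>e > 0\<close> p_gt_1 by (intro powr_less_mono2) auto
        then have "m * e powr p < m * norm ?x powr p" using m_pos by simp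
        then have bigv: "V ?x > v" using V_lower[of ?x] by (simp add: v_def)
        have t1: "t1 \<ge> 1" "t1 \<ge> t0" "t1 / h \<ge> 0" using h by (auto simp: t1_def)
        have late: "J \<noteq> 0 \<or> \<Delta> \<le> ts (Suc J)"
        proof (rule ccontr)
          assume "\<not> ?thesis"
          then have "s < 1" using s \<Delta> T TM by auto
          with Q t1 show False by simp
        qed
        note rd = run_decay[OF run level(3)[OF T] T0 \<Delta>(1) late]
        have "V (X 0 \<Delta>) \<le> U"
          unfolding U_def using rd(1) \<Delta> by (intro VK early(1)[OF T run \<Delta>(2) \<Delta>(1) _ _ r]) auto
        moreover have "exp (- (\<eta> * c) * (ts (Suc J) - \<Delta>)) \<le> exp (- (\<eta> * c) * (ts (Suc J) - 1))"
          using \<Delta> T TM eta c_pos by (simp add: mult_left_mono)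
        ultimately have "exp (- (\<eta> * c) * (ts (Suc J) - \<Delta>)) * V (X 0 \<Delta>) \<le> exp (- (\<eta> * c) * (ts (Suc J) - 1)) * U"
          using V_nonneg by (intro mult_mono) auto
        then have "v < exp (- (\<eta> * c) * (ts (Suc J) - 1)) * U" using rd(3) big bigv by linarith
        then have "ts (Suc J) < t0" using t0[of "ts (Suc J)"] by linarith
        then have tJ: "ts (Suc J) < t1" using t1 by simp
        have "(real J - 1) * h \<le> ts (Suc J)"
          using run_jump_count[OF run level(3)[OF T] T0 h(2,1) big] bigv \<delta> by simp
        then have "real J - 1 < t1 / h" using tJ h(1) by (simp add: field_simps)
        then show False using s Q tJ by simp
      qed
    qed
  qed
qed (rule that)

end

context switched_lyapunov
begin

section \<open>From hybrid solutions to runs\<close>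

text \<open>A closed set that contains the flow and the jump set, hence also all initial states and
  all end points of flow phases. On it the distance to the attractor depends on \<open>x\<close> only.\<close>
definition state_hull :: "real \<Rightarrow> 'n hstate set" where
  "state_hull T = UNIV \<times> real ` {1..N} \<times> {0..2 * T}"

lemma grad_V: "grad V x = G x"
  by (rule grad_eq[OF GDERIV_V])

lemma flow_set_subset_hull: "T > 0 \<Longrightarrow> flow_set N (affine_mode A b) V W \<eta> T \<subseteq> state_hull T"
  by (auto simp: flow_set_def flow_region_def state_hull_def)

lemma closed_state_hull: "closed (state_hull T)"
  unfolding state_hull_def
  by (intro closed_Times closed_UNIV closed_atLeastAtMost finite_imp_closed) simp

lemma initial_in_hull:
  assumes "T > 0" "\<phi>\<^sub>0 \<in> closure (flow_set N (affine_mode A b) V W \<eta> T) \<union> jump_set N (affine_mode A b) V W \<eta> T"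
  shows "\<phi>\<^sub>0 \<in> state_hull T"
proof -
  have "closure (flow_set N (affine_mode A b) V W \<eta> T) \<subseteq> state_hull T"
    using flow_set_subset_hull[OF \<open>T > 0\<close>] closed_state_hull by (rule closure_minimal)
  moreover have "jump_set N (affine_mode A b) V W \<eta> T \<subseteq> state_hull T"
    using \<open>T > 0\<close> by (auto simp: jump_set_def jump_region_def state_hull_def)
  ultimately show ?thesis using assms(2) by blast
qed

text \<open>The mode is recovered first, since its derivative vanishes almost everywhere; only then is the
  right-hand side of the flow equation known to be a continuous function of time, which makes the
  solution differentiable everywhere. If the timer were still at most \<open>T\<close> after \<open>T - \<tau>a\<close> time units, then by
  monotonicity it would have run at unit speed throughout and have passed \<open>T\<close>.\<close>
lemma flow_arc:
  assumes "T > 0" and "a < b'" and k: "k \<in> {1..N}"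
    and start: "\<phi> a = (xa, real k, \<tau>a)" "\<phi> a \<in> state_hull T"
    and ac: "abs_continuous_on {a..b'} \<phi>"
    and flow: "\<And>u. u \<in> {a<..<b'} \<Longrightarrow> \<phi> u \<in> flow_set N (affine_mode A b) V W \<eta> T"
    and neg: "negligible N0"
    and der: "\<And>u. u \<in> {a..b'} - N0 \<Longrightarrow>
        \<exists>d\<in>flow_map N (affine_mode A b) T (\<phi> u). (\<phi> has_vector_derivative d) (at u within {a..b'})"
  shows "is_arc k a b' (\<lambda>u. fst (\<phi> u))"
    and "\<And>u. u \<in> {a..b'} \<Longrightarrow> fst (snd (\<phi> u)) = real k"
    and "\<And>u. u \<in> {a..b'} \<Longrightarrow> snd (snd (\<phi> u)) \<in> {0..2 * T}"
    and "snd (snd (\<phi> b')) \<le> \<tau>a + (b' - a)"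
    and "\<And>u. \<lbrakk>u \<in> {a<..<b'}; T - \<tau>a < u - a\<rbrakk> \<Longrightarrow> rate k (fst (\<phi> u)) \<le> - \<eta> * W (fst (\<phi> u))"
proof -
  define f' where "f' u = (SOME d. d \<in> flow_map N (affine_mode A b) T (\<phi> u) \<and>
      (\<phi> has_vector_derivative d) (at u within {a..b'}))" for u
  have f': "f' u \<in> flow_map N (affine_mode A b) T (\<phi> u)" "(\<phi> has_vector_derivative f' u) (at u within {a..b'})"
    if "u \<in> {a..b'} - N0" for u
  proof -
    have "\<exists>d. d \<in> flow_map N (affine_mode A b) T (\<phi> u) \<and> (\<phi> has_vector_derivative d) (at u within {a..b'})"
      using der[OF that] by blast
    from someI_ex[OF this] show "f' u \<in> flow_map N (affine_mode A b) T (\<phi> u)"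
      "(\<phi> has_vector_derivative f' u) (at u within {a..b'})" by (simp_all add: f'_def)
  qed
  have cont: "continuous_on {a..b'} \<phi>" using ac by (rule abs_continuous_on_imp_continuous)
  show mode: "fst (snd (\<phi> u)) = real k" if u: "u \<in> {a..b'}" for u
  proof -
    have int: "(f' has_integral (\<phi> u - \<phi> a)) {a..u}"
    proof (rule abs_continuous_has_integral[OF _ _ neg])
      show "abs_continuous_on {a..u} \<phi>" using u by (intro abs_continuous_on_subset[OF ac]) auto
      show "(\<phi> has_vector_derivative f' v) (at v within {a..u})" if "v \<in> {a..u} - N0" for v
        using that u by (intro has_vector_derivative_within_subset[OF f'(2)]) auto
    qed (use u in simp)
    have "((\<lambda>v. fst (snd (f' v))) has_integral fst (snd (\<phi> u - \<phi> a))) {a..u}"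
      using has_integral_linear[OF int bounded_linear_compose[OF bounded_linear_fst bounded_linear_snd]]
      by (simp add: o_def)
    moreover have "((\<lambda>v. fst (snd (f' v))) has_integral 0) {a..u}"
    proof (rule has_integral_spike[OF neg _ has_integral_0])
      fix v assume "v \<in> {a..u} - N0"
      then have "f' v \<in> flow_map N (affine_mode A b) T (\<phi> v)" using u by (intro f'(1)) auto
      then show "fst (snd (f' v)) = 0" by (auto simp: flow_map_def split: prod.splits)
    qed
    ultimately have "fst (snd (\<phi> u - \<phi> a)) = 0" by (rule has_integral_unique)
    then show ?thesis using start(1) by simp
  qed
  define g where "g u = (affine_mode A b k (fst (\<phi> u)), 0::real, min 1 (2 - snd (snd (\<phi> u)) / T))" for u
  have g: "(\<phi> has_vector_derivative g u) (at u within {a..b'})" if "u \<in> {a..b'}" for u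
  proof (rule abs_continuous_has_vector_derivative[OF ac neg _ _ that])
    show "continuous_on {a..b'} g"
      unfolding g_def affine_mode_def using \<open>T > 0\<close>
      by (intro continuous_intros cont
        continuous_on_compose2[OF linear_continuous_on[OF matrix_vector_mul_bounded_linear[of "A k"], of UNIV]]) auto
    fix v assume v: "v \<in> {a..b'} - N0"
    then have "fst (snd (\<phi> v)) = real k" by (intro mode) auto
    then have "f' v = g v"
      using f'(1)[OF v] by (cases "\<phi> v") (auto simp: flow_map_def g_def)
    then show "(\<phi> has_vector_derivative g v) (at v within {a..b'})" using f'(2)[OF v] by simp
  qed
  show "is_arc k a b' (\<lambda>u. fst (\<phi> u))"
    unfolding is_arc_def
  proof
    fix u assume "u \<in> {a..b'}"
    from bounded_linear.has_vector_derivative[OF bounded_linear_fst g[OF this]]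
    show "((\<lambda>u. fst (\<phi> u)) has_vector_derivative affine_mode A b k (fst (\<phi> u))) (at u within {a..b'})"
      by (simp add: g_def)
  qed
  define \<tau> where "\<tau> u = snd (snd (\<phi> u))" for u
  have \<tau>_der: "(\<tau> has_real_derivative min 1 (2 - \<tau> u / T)) (at u within {a..b'})" if "u \<in> {a..b'}" for u
    using bounded_linear.has_vector_derivative[OF bounded_linear_compose[OF bounded_linear_snd bounded_linear_snd] g[OF that]]
    unfolding \<tau>_def[abs_def] by (simp add: g_def has_real_derivative_iff_has_vector_derivative)
  have \<tau>a: "\<tau> a = \<tau>a" using start by (simp add: \<tau>_def)
  have "\<tau> ` closure {a<..<b'} \<subseteq> {0..2 * T}"
  proof (rule image_closure_subset)
    show "continuous_on (closure {a<..<b'}) \<tau>"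
      unfolding \<tau>_def using cont \<open>a < b'\<close> by (auto intro!: continuous_intros)
    show "\<tau> ` {a<..<b'} \<subseteq> {0..2 * T}"
      using flow flow_set_subset_hull[OF \<open>T > 0\<close>] by (force simp: \<tau>_def state_hull_def)
  qed simp
  then have \<tau>_range: "\<tau> u \<in> {0..2 * T}" if "u \<in> {a..b'}" for u
    using that \<open>a < b'\<close> by (simp only: closure_greaterThanLessThan image_subset_iff)
  then show "snd (snd (\<phi> u)) \<in> {0..2 * T}" if "u \<in> {a..b'}" for u
    using that by (simp add: \<tau>_def)
  have "\<tau> b' - b' \<le> \<tau> a - a"
  proof (rule decreasing_if_derivative_nonpos[where g = "\<lambda>u. \<tau> u - u" and a = a and b = b'])
    show "((\<lambda>u. \<tau> u - u) has_real_derivative min 1 (2 - \<tau> u / T) - 1) (at u within {a..b'})" if "u \<in> {a..b'}" for u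
      using \<tau>_der[OF that] by (auto intro!: derivative_eq_intros)
  qed (use \<open>a < b'\<close> in auto)
  then show "snd (snd (\<phi> b')) \<le> \<tau>a + (b' - a)" using \<tau>a by (simp add: \<tau>_def)
  have \<tau>_mono: "\<tau> u \<le> \<tau> v" if "a \<le> u" "u \<le> v" "v \<le> b'" for u v
  proof -
    have "- \<tau> v \<le> - \<tau> u"
    proof (rule decreasing_if_derivative_nonpos[where g = "\<lambda>u. - \<tau> u" and a = u and b = b'])
      show "((\<lambda>u. - \<tau> u) has_real_derivative - min 1 (2 - \<tau> w / T)) (at w within {u..b'})" if "w \<in> {u..b'}" for w
        using DERIV_subset[OF \<tau>_der, of w "{u..b'}"] that \<open>a \<le> u\<close> by (auto intro!: derivative_eq_intros)
      show "- min 1 (2 - \<tau> w / T) \<le> 0" if "w \<in> {u<..<b'}" for w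
        using \<tau>_range[of w] that \<open>a \<le> u\<close> \<open>T > 0\<close> by (auto simp: min_def field_simps)
    qed (use that in auto)
    then show ?thesis by simp
  qed
  show "rate k (fst (\<phi> u)) \<le> - \<eta> * W (fst (\<phi> u))" if u: "u \<in> {a<..<b'}" and late: "T - \<tau>a < u - a" for u
  proof -
    have "\<tau> u > T"
    proof (rule ccontr)
      assume "\<not> \<tau> u > T"
      have "u - \<tau> u \<le> a - \<tau> a"
      proof (rule decreasing_if_derivative_nonpos[where g = "\<lambda>u. u - \<tau> u" and a = a and b = u])
        show "((\<lambda>u. u - \<tau> u) has_real_derivative 1 - min 1 (2 - \<tau> w / T)) (at w within {a..u})" if "w \<in> {a..u}" for w
          using DERIV_subset[OF \<tau>_der, of w "{a..u}"] that u by (auto intro!: derivative_eq_intros)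
        show "1 - min 1 (2 - \<tau> w / T) \<le> 0" if "w \<in> {a<..<u}" for w
          using \<tau>_mono[of w u] that u \<open>\<not> \<tau> u > T\<close> \<open>T > 0\<close> by (auto simp: min_def field_simps)
      qed (use u in auto)
      then show False using late \<open>\<not> \<tau> u > T\<close> \<tau>a by simp
    qed
    moreover have "\<phi> u = (fst (\<phi> u), real k, \<tau> u)"
      using mode[of u] u by (simp add: \<tau>_def prod_eq_iff)
    ultimately have "(fst (\<phi> u), real k) \<in> flow_region N (affine_mode A b) V W \<eta>"
      using flow[OF u] by (auto simp: flow_set_def)
    then show ?thesis by (auto simp: flow_region_def grad_V rate_def)
  qed
qed

text \<open>The argument works on the division of the time domain up to \<open>(t, J)\<close>, not on the whole flow intervals: a
  flow interval may extend beyond the jump time at which a next phase branches off.\<close>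
lemma solution_is_run:
  assumes sol: "regularized_solution N (affine_mode A b) V W \<eta> T E \<phi>" and "T > 0"
    and init: "\<phi> 0 0 = (x\<^sub>0, \<sigma>\<^sub>0, \<tau>\<^sub>0)" and tJ: "(t, J) \<in> E"
    and best: "\<And>x k. is_arg_min (\<lambda>k. grad V x \<bullet> affine_mode A b k x) (\<lambda>k. k \<in> {1..N}) k \<Longrightarrow> rate k x \<le> - W x"
  obtains ts k where "switching_run T (max 0 (T - \<tau>\<^sub>0)) J ts k (\<lambda>i u. fst (\<phi> u i))" "ts (Suc J) = t"
    and "\<phi> 0 0 \<in> state_hull T" "\<phi> t J \<in> state_hull T"
proof -
  have htd: "hybrid_time_domain E"
    and lac: "\<And>i. locally_abs_continuous_on (flow_interval E i) (\<lambda>t. \<phi> t i)"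
    and start: "\<phi> 0 0 \<in> closure (flow_set N (affine_mode A b) V W \<eta> T) \<union> jump_set N (affine_mode A b) V W \<eta> T"
    and flows: "\<And>i u. u \<in> interior (flow_interval E i) \<Longrightarrow> \<phi> u i \<in> flow_set N (affine_mode A b) V W \<eta> T"
    and ders: "\<And>i. interior (flow_interval E i) \<noteq> {} \<Longrightarrow> AE u in lebesgue. u \<in> flow_interval E i \<longrightarrow>
           (\<exists>d\<in>flow_map N (affine_mode A b) T (\<phi> u i). ((\<lambda>s. \<phi> s i) has_vector_derivative d) (at u within flow_interval E i))"
    and jumps: "\<And>u i. \<lbrakk>(u, i) \<in> E; (u, Suc i) \<in> E\<rbrakk> \<Longrightarrow> \<phi> u i \<in> jump_set N (affine_mode A b) V W \<eta> T \<and>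
           \<phi> u (Suc i) \<in> jump_map N (affine_mode A b) V (\<phi> u i)"
    using sol unfolding regularized_solution_def hybrid_solution_def by blast+
  have "t \<ge> 0" using htd tJ unfolding hybrid_time_domain_def by blast
  obtain ts where ts: "ts 0 = 0" "\<And>i. i \<le> J \<Longrightarrow> ts i \<le> ts (Suc i)"
    "E \<inter> ({0..t} \<times> {..J}) = (\<Union>i\<in>{..J}. {ts i..ts (Suc i)} \<times> {i})"
    using htd tJ unfolding hybrid_time_domain_def by blast
  have inE: "(u, i) \<in> E" "u \<le> t" if "i \<le> J" "u \<in> {ts i..ts (Suc i)}" for u i
  proof -
    have "(u, i) \<in> E \<inter> ({0..t} \<times> {..J})" unfolding ts(3) using that by auto
    then show "(u, i) \<in> E" "u \<le> t" by auto
  qed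
  have "(t, J) \<in> (\<Union>i\<in>{..J}. {ts i..ts (Suc i)} \<times> {i})"
    unfolding ts(3)[symmetric] using tJ \<open>t \<ge> 0\<close> by simp
  then have "t \<le> ts (Suc J)" by auto
  moreover have "ts (Suc J) \<le> t" using inE(2)[of J "ts (Suc J)"] ts(2)[of J] by simp
  ultimately have tsJ: "ts (Suc J) = t" by simp
  have hull0: "\<phi> 0 0 \<in> state_hull T" by (rule initial_in_hull[OF \<open>T > 0\<close> start])
  have jump: "(ts (Suc i), i) \<in> E" "(ts (Suc i), Suc i) \<in> E" if "i < J" for i
    using inE(1)[of i "ts (Suc i)"] inE(1)[of "Suc i" "ts (Suc i)"] ts(2)[of i] ts(2)[of "Suc i"] that by auto
  have begin_phase: "\<exists>k\<in>{1..N}. \<phi> (ts i) i = (fst (\<phi> (ts i) i), real k, if i = 0 then \<tau>\<^sub>0 else 0) \<and> \<phi> (ts i) i \<in> state_hull T"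
    if "i \<le> J" for i
  proof (cases i)
    case 0
    then show ?thesis using hull0 init ts(1) by (auto simp: state_hull_def)
  next
    case (Suc i')
    then have "\<phi> (ts i) i \<in> jump_map N (affine_mode A b) V (\<phi> (ts i) i')" using jumps[OF jump, of i'] that by simp
    then obtain k where "\<phi> (ts i) i = (fst (\<phi> (ts i) i'), real k, 0)" "k \<in> {1..N}"
      by (auto simp: jump_map_def is_arg_min_def split: prod.splits)
    then show ?thesis using Suc \<open>T > 0\<close> by (intro bexI[of _ k]) (auto simp: state_hull_def)
  qed
  then obtain k where k: "\<And>i. i \<le> J \<Longrightarrow> k i \<in> {1..N}"
    and ki: "\<And>i. i \<le> J \<Longrightarrow> \<phi> (ts i) i = (fst (\<phi> (ts i) i), real (k i), if i = 0 then \<tau>\<^sub>0 else 0)"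
    and hull: "\<And>i. i \<le> J \<Longrightarrow> \<phi> (ts i) i \<in> state_hull T"
    by metis
  have phase: "is_arc (k i) (ts i) (ts (Suc i)) (\<lambda>u. fst (\<phi> u i)) \<and>
      (\<forall>u\<in>{ts i..ts (Suc i)}. fst (snd (\<phi> u i)) = real (k i)) \<and>
      (\<forall>u\<in>{ts i..ts (Suc i)}. snd (snd (\<phi> u i)) \<in> {0..2 * T}) \<and>
      snd (snd (\<phi> (ts (Suc i)) i)) \<le> (if i = 0 then \<tau>\<^sub>0 else 0) + (ts (Suc i) - ts i) \<and>
      (\<forall>u\<in>{ts i<..<ts (Suc i)}. T - (if i = 0 then \<tau>\<^sub>0 else 0) < u - ts i \<longrightarrow>
         rate (k i) (fst (\<phi> u i)) \<le> - \<eta> * W (fst (\<phi> u i)))"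
    if i: "i \<le> J" for i
  proof (cases "ts i = ts (Suc i)")
    case True
    have "fst (snd (\<phi> (ts i) i)) = real (k i)" "snd (snd (\<phi> (ts i) i)) = (if i = 0 then \<tau>\<^sub>0 else 0)"
      by (subst ki[OF i], simp)+
    then show ?thesis using True[symmetric] hull[OF i]
      by (auto simp: is_arc_def has_vector_derivative_def state_hull_def has_derivative_within_singleton_iff bounded_linear_scaleR_left)
  next
    case False
    then have less: "ts i < ts (Suc i)" using ts(2)[OF i] by simp
    have sub: "{ts i..ts (Suc i)} \<subseteq> flow_interval E i" using inE(1)[OF i] by (auto simp: flow_interval_def)
    have int: "{ts i<..<ts (Suc i)} \<subseteq> interior (flow_interval E i)"
      using sub by (intro interior_maximal) auto
    then have "interior (flow_interval E i) \<noteq> {}" using less by auto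
    from ders[OF this] obtain N0 where N0: "N0 \<in> null_sets lebesgue"
      "{u \<in> space lebesgue. \<not> (u \<in> flow_interval E i \<longrightarrow> (\<exists>d\<in>flow_map N (affine_mode A b) T (\<phi> u i).
          ((\<lambda>s. \<phi> s i) has_vector_derivative d) (at u within flow_interval E i)))} \<subseteq> N0"
      unfolding eventually_ae_filter by blast
    have neg: "negligible N0" using N0(1) by (simp add: negligible_iff_null_sets)
    have der: "\<exists>d\<in>flow_map N (affine_mode A b) T (\<phi> u i). ((\<lambda>s. \<phi> s i) has_vector_derivative d) (at u within {ts i..ts (Suc i)})"
      if "u \<in> {ts i..ts (Suc i)} - N0" for u
    proof -
      have u: "u \<in> space lebesgue" "u \<in> flow_interval E i" "u \<notin> N0" using that sub by auto
      then have "\<exists>d\<in>flow_map N (affine_mode A b) T (\<phi> u i).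
          ((\<lambda>s. \<phi> s i) has_vector_derivative d) (at u within flow_interval E i)"
        using N0(2) by blast
      then show ?thesis using has_vector_derivative_within_subset[OF _ sub] by blast
    qed
    have ac: "abs_continuous_on {ts i..ts (Suc i)} (\<lambda>u. \<phi> u i)"
      using lac[of i] sub unfolding locally_abs_continuous_on_def by blast
    have fl: "\<phi> u i \<in> flow_set N (affine_mode A b) V W \<eta> T" if "u \<in> {ts i<..<ts (Suc i)}" for u
      using flows int that by blast
    note fa = flow_arc[OF \<open>T > 0\<close> less k[OF i] ki[OF i] hull[OF i] ac fl neg der]
    show ?thesis using fa by blast
  qed
  have "switching_run T (max 0 (T - \<tau>\<^sub>0)) J ts k (\<lambda>i u. fst (\<phi> u i))"
    unfolding switching_run_def
  proof (intro conjI allI impI ballI)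
    show "ts 0 = 0" by (rule ts(1))
    fix i assume i: "i \<le> J"
    show "k i \<in> {1..N}" "ts i \<le> ts (Suc i)" using k ts(2) i by auto
    show "is_arc (k i) (ts i) (ts (Suc i)) (\<lambda>u. fst (\<phi> u i))" using phase[OF i] by blast
    fix u assume u: "u \<in> {ts i<..<ts (Suc i)}" "(if i = 0 then max 0 (T - \<tau>\<^sub>0) else T) < u - ts i"
    then have "T - (if i = 0 then \<tau>\<^sub>0 else 0) < u - ts i" by (auto split: if_splits)
    then show "rate (k i) (fst (\<phi> u i)) \<le> - \<eta> * W (fst (\<phi> u i))" using phase[OF i] u(1) by blast
  next
    fix i assume i: "i < J"
    let ?z = "\<phi> (ts (Suc i)) i"
    have iJ: "i \<le> J" "Suc i \<le> J" using i by auto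
    have D: "?z \<in> jump_set N (affine_mode A b) V W \<eta> T"
      and Gm: "\<phi> (ts (Suc i)) (Suc i) \<in> jump_map N (affine_mode A b) V ?z"
      using jumps[OF jump[OF i]] by auto
    have end_in: "ts (Suc i) \<in> {ts i..ts (Suc i)}" using ts(2)[OF iJ(1)] by simp
    have "snd (snd ?z) \<ge> T" using D by (auto simp: jump_set_def)
    then show "(if i = 0 then max 0 (T - \<tau>\<^sub>0) else T) \<le> ts (Suc i) - ts i"
      using phase[OF iJ(1)] ts(2)[OF iJ(1)] by auto
    have "fst (snd ?z) = real (k i)" using phase[OF iJ(1)] end_in by blast
    then show "- \<eta> * W (fst ?z) \<le> rate (k i) (fst ?z)"
      using D by (auto simp: jump_set_def jump_region_def rate_def grad_V)
    obtain k' where k': "\<phi> (ts (Suc i)) (Suc i) = (fst ?z, real k', 0)"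
      "is_arg_min (\<lambda>k. grad V (fst ?z) \<bullet> affine_mode A b k (fst ?z)) (\<lambda>k. k \<in> {1..N}) k'"
      using Gm by (auto simp: jump_map_def split: prod.splits)
    show "fst (\<phi> (ts (Suc i)) (Suc i)) = fst ?z" using k'(1) by simp
    have "k' = k (Suc i)" using ki[OF iJ(2)] k'(1) by simp
    then show "rate (k (Suc i)) (fst ?z) \<le> - W (fst ?z)" using best[OF k'(2)] by simp
  qed
  moreover have "\<phi> t J \<in> state_hull T"
  proof -
    have "t \<in> {ts J..ts (Suc J)}" using tsJ ts(2)[of J] by simp
    then have "fst (snd (\<phi> t J)) = real (k J)" "snd (snd (\<phi> t J)) \<in> {0..2 * T}"
      using phase[of J] by auto
    then show ?thesis using k[of J] by (cases "\<phi> t J") (auto simp: state_hull_def)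
  qed
  ultimately show thesis using that tsJ hull0 by blast
qed

end

section \<open>The stability theorem\<close>

lemma infdist_Times:
  assumes "w \<in> Q" "S \<noteq> {}"
  shows "infdist (x, w) (S \<times> Q) = infdist x S"
proof (rule antisym)
  have ne: "S \<times> Q \<noteq> {}" using assms by auto
  show "infdist (x, w) (S \<times> Q) \<le> infdist x S"
    unfolding infdist_notempty[OF \<open>S \<noteq> {}\<close>]
  proof (rule cINF_greatest[OF \<open>S \<noteq> {}\<close>])
    fix y assume "y \<in> S"
    then have "infdist (x, w) (S \<times> Q) \<le> dist (x, w) (y, w)" using \<open>w \<in> Q\<close> by (intro infdist_le) auto
    then show "infdist (x, w) (S \<times> Q) \<le> dist x y" by (simp add: dist_Pair_Pair)
  qed
  show "infdist x S \<le> infdist (x, w) (S \<times> Q)"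
    unfolding infdist_notempty[OF ne]
  proof (rule cINF_greatest[OF ne])
    fix z assume "z \<in> S \<times> Q"
    then have "infdist x S \<le> dist x (fst z)" by (intro infdist_le) auto
    also have "\<dots> \<le> dist (x, w) z" using dist_fst_le[of "(x, w)" z] by simp
    finally show "infdist x S \<le> dist (x, w) z" .
  qed
qed

lemma sum_matrix_vector_mult:
  fixes B :: "nat \<Rightarrow> real^'n^'m"
  shows "(\<Sum>i\<in>I. l i *\<^sub>R B i) *v x = (\<Sum>i\<in>I. l i *\<^sub>R (B i *v x))"
  by (induction I rule: infinite_finite_induct)
     (simp_all add: matrix_vector_mult_add_rdistrib scaleR_matrix_vector_assoc)

lemma arg_min_le_average:
  fixes g :: "nat \<Rightarrow> real"
  assumes "is_arg_min g (\<lambda>k. k \<in> {1..N}) k" "\<forall>i\<in>{1..N}. 0 \<le> l i" "(\<Sum>i=1..N. l i) = 1"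
  shows "g k \<le> (\<Sum>i=1..N. l i * g i)"
proof -
  have "g k = (\<Sum>i=1..N. l i * g k)" using assms(3) by (simp flip: sum_distrib_right)
  also have "\<dots> \<le> (\<Sum>i=1..N. l i * g i)"
    using assms(1,2) by (intro sum_mono mult_left_mono) (auto simp: is_arg_min_linorder)
  finally show ?thesis .
qed

theorem mainTheorem4:
  fixes A :: "nat \<Rightarrow> real^'n^'n" and b :: "nat \<Rightarrow> real^'n" and N :: nat
    and l :: "nat \<Rightarrow> real" and p \<eta> :: real
    and R :: "real^'n^'r" and S :: "real^'n^'s"
  assumes "\<forall>i\<in>{1..N}. l i \<in> {0..1}" and "(\<Sum>i=1..N. l i) = 1"
    and "Hurwitz (\<Sum>i=1..N. l i *\<^sub>R A i)"
    and "(\<Sum>i=1..N. l i *\<^sub>R b i) = 0"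
    and "p > 1"
    and "full_column_rank R" and "full_column_rank S"
    and "\<forall>x. grad (wnorm_fun R p) x \<bullet> ((\<Sum>i=1..N. l i *\<^sub>R A i) *v x) + wnorm_fun S p x \<le> 0"
    and "\<eta> \<in> {0<..<1}"
  shows "\<exists>TM>0. \<exists>\<epsilon> :: real \<Rightarrow> real. \<exists>\<beta> \<alpha>.
    strict_mono_on {0<..<TM} \<epsilon> \<and> (\<forall>T\<in>{0<..<TM}. \<epsilon> T > 0) \<and> (\<epsilon> \<longlongrightarrow> 0) (at_right 0) \<and>
    class_KL \<beta> \<and> class_Kinf \<alpha> \<and>
    (\<forall>T\<in>{0<..<TM}. \<forall>E \<phi> x\<^sub>0 \<sigma>\<^sub>0 \<tau>\<^sub>0.
       regularized_solution N (affine_mode A b) (wnorm_fun R p) (wnorm_fun S p) \<eta> T E \<phi> \<and>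
       \<phi> 0 0 = (x\<^sub>0, \<sigma>\<^sub>0, \<tau>\<^sub>0) \<longrightarrow>
       (let \<A> = attractor N (wnorm_fun R p) (\<epsilon> T) T; \<Delta>\<^sub>0 = max 0 (T - \<tau>\<^sub>0) in
        \<forall>(t, j)\<in>E.
          infdist (\<phi> t j) \<A> \<le> \<beta> (infdist (\<phi> 0 0) \<A> + \<alpha> \<Delta>\<^sub>0) (t + real j) \<and>
          t \<ge> (real j - 1) * T))"
proof -
  define V where "V = wnorm_fun R p"
  define W where "W = wnorm_fun S p"
  define G where "G = wnorm_grad R p"
  have p: "p > 1" by fact
  have GD: "GDERIV V x :> G x" for x unfolding V_def G_def by (rule GDERIV_wnorm_fun[OF p])
  have contW: "continuous_on UNIV W" and contV: "continuous_on UNIV V"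
    unfolding V_def W_def using GDERIV_wnorm_fun[OF p] unfolding gderiv_def
    by (meson continuous_at_imp_continuous_on has_derivative_continuous)+
  have Vs: "V (s *\<^sub>R x) = s powr p * V x" and Ws: "W (s *\<^sub>R x) = s powr p * W x" if "s \<ge> 0" for s x
    using that by (simp_all add: V_def W_def wnorm_fun_scale)
  obtain m M where mM: "m > 0" "M > 0" "\<And>x. m * norm x powr p \<le> V x" "\<And>x. V x \<le> M * norm x powr p"
    using homogeneous_bounds[OF contV Vs] wnorm_fun_pos[OF assms(6)] p unfolding V_def by auto
  obtain m' M' where mM': "m' > 0" "M' > 0" "\<And>x. m' * norm x powr p \<le> W x" "\<And>x. W x \<le> M' * norm x powr p"
    using homogeneous_bounds[OF contW Ws] wnorm_fun_pos[OF assms(7)] p unfolding W_def by auto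
  define c where "c = m' / M"
  have c: "c > 0" using mM mM' by (simp add: c_def)
  have cW: "c * V x \<le> W x" for x
  proof -
    have "c * V x \<le> c * (M * norm x powr p)" using mM(4) c by (intro mult_left_mono) auto
    also have "\<dots> = m' * norm x powr p" using mM(2) by (simp add: c_def)
    also have "\<dots> \<le> W x" by (rule mM'(3))
    finally show ?thesis .
  qed
  define L where "L = 1 + (\<Sum>k=1..N. onorm ((*v) (A k))) + (\<Sum>k=1..N. norm (b k))"
  have on: "onorm ((*v) (A k)) \<ge> 0" for k by (rule onorm_pos_le[OF matrix_vector_mul_bounded_linear])
  have L1: "L \<ge> 1" unfolding L_def using on by (auto intro!: add_increasing2 sum_nonneg)
  have LA: "norm (A k *v v) \<le> L * norm v" if "k \<in> {1..N}" for k v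
  proof -
    have "onorm ((*v) (A k)) \<le> (\<Sum>k=1..N. onorm ((*v) (A k)))" using that on by (intro member_le_sum) auto
    moreover have "0 \<le> (\<Sum>k=1..N. norm (b k))" by (rule sum_nonneg) simp
    ultimately have "onorm ((*v) (A k)) \<le> L" by (simp add: L_def)
    then show ?thesis
      using onorm[OF matrix_vector_mul_bounded_linear, of "A k" v] by (meson mult_right_mono norm_ge_zero order_trans)
  qed
  have Lb: "norm (b k) \<le> L" if "k \<in> {1..N}" for k
  proof -
    have "norm (b k) \<le> (\<Sum>k=1..N. norm (b k))" using that by (intro member_le_sum) auto
    moreover have "0 \<le> (\<Sum>k=1..N. onorm ((*v) (A k)))" using on by (rule sum_nonneg)
    ultimately show ?thesis by (simp add: L_def)
  qed
  interpret switched_lyapunov N A b V W G p \<eta> L m M c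
  proof
    show "continuous_on UNIV G" unfolding G_def by (rule continuous_wnorm_grad[OF p])
    show "G (s *\<^sub>R x) = s powr (p - 1) *\<^sub>R G x" if "s > 0" for s x
      unfolding G_def by (rule wnorm_grad_scale[OF that])
  qed (use p GD contW Vs Ws mM c cW L1 LA Lb assms(9) in auto)
  have best: "rate k x \<le> - W x"
    if "is_arg_min (\<lambda>k. grad V x \<bullet> affine_mode A b k x) (\<lambda>k. k \<in> {1..N}) k" for x k
  proof -
    have "rate k x \<le> (\<Sum>i=1..N. l i * (G x \<bullet> affine_mode A b i x))"
      using arg_min_le_average[OF that _ assms(2)] assms(1) by (simp add: rate_def grad_V)
    also have "\<dots> = G x \<bullet> (\<Sum>i=1..N. l i *\<^sub>R affine_mode A b i x)"
      by (simp add: inner_sum_right)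
    also have "(\<Sum>i=1..N. l i *\<^sub>R affine_mode A b i x) = (\<Sum>i=1..N. l i *\<^sub>R A i) *v x"
      using assms(4) by (simp add: affine_mode_def scaleR_right_distrib sum.distrib sum_matrix_vector_mult)
    also have "G x \<bullet> \<dots> \<le> - W x"
    proof -
      have "grad V x \<bullet> ((\<Sum>i=1..N. l i *\<^sub>R A i) *v x) + W x \<le> 0"
        using assms(8) by (simp add: V_def W_def)
      then show ?thesis by (simp add: grad_V)
    qed
    finally show ?thesis .
  qed
  obtain h where h: "h > 0" "dwell 1 h" using dwell_exists[of 1] by auto
  define TM where "TM = min 1 h"
  have TM: "TM > 0" "TM \<le> 1" "dwell 1 TM" using h dwell_mono[OF h(2), of 1 TM] by (auto simp: TM_def)
  obtain \<beta> where \<beta>: "class_KL \<beta>" "\<And>r s d. run_triple TM r s d \<Longrightarrow> d \<le> \<beta> r s"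
    using run_triple_KL[OF TM(3,1,2)] by blast
  have main: "infdist (\<phi> t j) (attractor N V (level T) T) \<le> \<beta> (infdist (\<phi> 0 0) (attractor N V (level T) T) + max 0 (T - \<tau>\<^sub>0)) (t + real j)
      \<and> t \<ge> (real j - 1) * T"
    if T: "T \<in> {0<..<TM}" and sol: "regularized_solution N (affine_mode A b) V W \<eta> T E \<phi>"
      and init: "\<phi> 0 0 = (x\<^sub>0, \<sigma>\<^sub>0, \<tau>\<^sub>0)" and tj: "(t, j) \<in> E" for T E \<phi> x\<^sub>0 \<sigma>\<^sub>0 \<tau>\<^sub>0 t j
  proof -
    have T0: "T > 0" using T by simp
    obtain ts k where run: "switching_run T (max 0 (T - \<tau>\<^sub>0)) j ts k (\<lambda>i u. fst (\<phi> u i))" "ts (Suc j) = t"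
      and hull: "\<phi> 0 0 \<in> state_hull T" "\<phi> t j \<in> state_hull T"
      by (rule solution_is_run[OF sol T0 init tj best])
    have "level T > 0" using level_pos[OF TM(3), of T] T by simp
    then have ne: "sublevel (level T) \<noteq> {}" using zero_in_sublevel[of "level T"] by auto
    have att: "infdist z (attractor N V (level T) T) = infdist (fst z) (sublevel (level T))"
      if "z \<in> state_hull T" for z
      using infdist_Times[of "snd z" "real ` {1..N} \<times> {0..2 * T}" "sublevel (level T)" "fst z"] that ne
      by (cases z) (auto simp: attractor_def sublevel_def state_hull_def)
    have "\<tau>\<^sub>0 \<ge> 0" using hull(1) init by (simp add: state_hull_def)
    then have "run_triple TM (infdist (fst (\<phi> 0 0)) (sublevel (level T)) + max 0 (T - \<tau>\<^sub>0)) (t + real j)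
        (infdist (fst (\<phi> t j)) (sublevel (level T)))"
      unfolding run_triple_def using T run
      by (intro exI[of _ T] exI[of _ "max 0 (T - \<tau>\<^sub>0)"] exI[of _ j] exI[of _ ts] exI[of _ k]
          exI[of _ "\<lambda>i u. fst (\<phi> u i)"]) auto
    moreover have "(real j - 1) * T \<le> t"
      unfolding run(2)[symmetric]
    proof (rule run_dwell_time[OF run(1)])
      show "T \<le> ts (Suc i) - ts i" if "1 \<le> i" "i < j" for i
        using run_jump(1)[OF run(1) that(2)] that(1) by simp
    qed (use T0 in simp)
    ultimately show ?thesis using \<beta>(2) by (simp add: att[OF hull(1)] att[OF hull(2)])
  qed
  have Kinf: "class_Kinf (\<lambda>r. r)"
  proof -
    have "\<not> bdd_above ((\<lambda>r::real. r) ` {0..})"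
    proof
      assume "bdd_above ((\<lambda>r::real. r) ` {0..})"
      then obtain B where B: "\<And>r::real. r \<ge> 0 \<Longrightarrow> r \<le> B" by (auto simp: bdd_above_def)
      from B[of "max 0 B + 1"] show False by simp
    qed
    then show ?thesis by (auto simp: class_Kinf_def strict_mono_on_def)
  qed
  show ?thesis
    unfolding Let_def V_def[symmetric] W_def[symmetric]
  proof (rule exI[of _ TM], rule conjI[OF TM(1)], rule exI[of _ level], rule exI[of _ \<beta>],
      rule exI[of _ "\<lambda>r. r"], intro conjI)
    show "strict_mono_on {0<..<TM} level"
      using level_strict_mono[OF TM(3)] by (auto simp: strict_mono_on_def)
    show "\<forall>T\<in>{0<..<TM}. level T > 0" using level_pos[OF TM(3)] by simp
    show "(level \<longlongrightarrow> 0) (at_right 0)" by (rule level_tendsto[OF TM(3,1)])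
  qed (use \<beta> Kinf main in blast)+
qed

end
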